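(* Let $m,n$ be non-zero integers. Then the set of scales of elements of $G_{m,n}$ is $$\{s(x)\mid x\in G_{m,n}\}=\left\{ \left(\frac{\operatorname{lcm}(m,n)}{|n|}\right)^{\rho},\ \left(\frac{\operatorname{lcm}(m,n)}{|m|}\right)^{\rho}\ \middle|\ \rho\in\mathbb{N}\right\}.$$
   Context: $\mathbb{N}$ includes $0$; $\operatorname{lcm}(m,n)>0$. For non-zero integers $m,n$, $\mathrm{BS}(m,n)=\langle a,t\mid ta^mt^{-1}=a^n\rangle$. Let $\pi:\mathrm{BS}(m,n)\to \mathrm{Sym}(\mathrm{BS}(m,n)/\langle a\rangle)$ be the action by left multiplication on left cosets of $\langle a\rangle$. $\mathrm{Sym}(\mathrm{BS}(m,n)/\langle a\rangle)$ has the topology of pointwise convergence, with basis the sets $\mathcal N(x,F)=\{y\mid y(c)=x(c)\ \forall c\in F\}$, $F$ a finite set of cosets. $G_{m,n}$ is the closure of the image of $\pi$ with the subspace topology; it is a totally disconnected locally compact group. (If $|m|=|n|$ then $\ker\pi=\langle a^m\rangle$ and $G_{m,n}\cong\mathrm{BS}(m,n)/\langle a^m\rangle$ is discrete.) For a totally disconnected locally compact group $G$ and $x\in G$, the scale of $x$ is $s(x)=\min\{[V:V\cap x^{-1}Vx]\mid V\text{ a compact open subgroup of }G\}$. *)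

theory Defs
  imports "HOL-Analysis.Analysis" "HOL-Algebra.Bij" "HOL-Algebra.Left_Coset"
    "HOL-Algebra.Generated_Groups"
begin

section \<open>Groups given by generators and relations\<close>

text \<open>A word over \<open>'g\<close> is a list of letters; \<open>(g, True)\<close> stands for the generator \<open>g\<close> and
  \<open>(g, False)\<close> for its formal inverse.  A defining relation \<open>l = r\<close> is a pair of words.\<close>

type_synonym 'g word = "('g \<times> bool) list"

inductive pres_eq :: "('g word \<times> 'g word) set \<Rightarrow> 'g word \<Rightarrow> 'g word \<Rightarrow> bool"
  for R :: "('g word \<times> 'g word) set" where
  refl: "pres_eq R u u"
| sym: "pres_eq R u v \<Longrightarrow> pres_eq R v u"
| trans: "pres_eq R u v \<Longrightarrow> pres_eq R v w \<Longrightarrow> pres_eq R u w"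
| cancel: "pres_eq R (u @ [(g, b), (g, \<not> b)] @ v) (u @ v)"
| relation: "(l, r) \<in> R \<Longrightarrow> pres_eq R (u @ l @ v) (u @ r @ v)"

definition pres_rel :: "('g word \<times> 'g word) set \<Rightarrow> ('g word \<times> 'g word) set" where
  "pres_rel R = {(u, v). pres_eq R u v}"

definition presented_group :: "('g word \<times> 'g word) set \<Rightarrow> 'g word set monoid" where
  "presented_group R =
    \<lparr>carrier = UNIV // pres_rel R,
     mult = (\<lambda>X Y. \<Union>u\<in>X. \<Union>v\<in>Y. pres_rel R `` {u @ v}),
     one = pres_rel R `` {[]}\<rparr>"

lemma equiv_pres_rel: "equiv UNIV (pres_rel R)"
  by (rule equivI)
     (auto simp: pres_rel_def refl_on_def sym_def trans_def
           intro: pres_eq.refl pres_eq.sym pres_eq.trans)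

lemma pres_eq_context: "pres_eq R u v \<Longrightarrow> pres_eq R (p @ u @ q) (p @ v @ q)"
proof (induction rule: pres_eq.induct)
  case (cancel u g b v)
  show ?case using pres_eq.cancel[of R "p @ u" g b "v @ q"] by simp
next
  case (relation l r u v)
  then show ?case using pres_eq.relation[of l r R "p @ u" "v @ q"] by simp
qed (blast intro: pres_eq.refl pres_eq.sym pres_eq.trans)+

lemma pres_eq_append:
  assumes "pres_eq R u u'" "pres_eq R v v'"
  shows "pres_eq R (u @ v) (u' @ v')"
  using pres_eq_context[OF assms(1), of "[]" v] pres_eq_context[OF assms(2), of u' "[]"]
  by (auto intro: pres_eq.trans)

lemma presented_group_mult:
  "(pres_rel R `` {u}) \<otimes>\<^bsub>presented_group R\<^esub> (pres_rel R `` {v}) = pres_rel R `` {u @ v}"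
proof -
  have "pres_rel R `` {u' @ v'} = pres_rel R `` {u @ v}"
    if "u' \<in> pres_rel R `` {u}" "v' \<in> pres_rel R `` {v}" for u' v'
    using that pres_eq_append[of R u u' v v']
    by (intro equiv_class_eq[OF equiv_pres_rel])
       (auto simp: pres_rel_def intro: pres_eq.sym)
  moreover have "u \<in> pres_rel R `` {u}" "v \<in> pres_rel R `` {v}"
    by (auto simp: pres_rel_def pres_eq.refl)
  ultimately have "(\<Union>u'\<in>pres_rel R `` {u}. \<Union>v'\<in>pres_rel R `` {v}. pres_rel R `` {u' @ v'}) =
      pres_rel R `` {u @ v}"
    by blast
  then show ?thesis by (simp add: presented_group_def)
qed

definition word_inv :: "'g word \<Rightarrow> 'g word" where
  "word_inv w = rev (map (\<lambda>(g, b). (g, \<not> b)) w)"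

lemma pres_eq_word_inv: "pres_eq R (word_inv w @ w) []"
proof (induction w)
  case Nil
  then show ?case by (simp add: word_inv_def pres_eq.refl)
next
  case (Cons x w)
  obtain g b where x: "x = (g, b)" by fastforce
  have "pres_eq R (word_inv w @ [(g, \<not> b), (g, \<not> \<not> b)] @ w) (word_inv w @ w)"
    by (rule pres_eq.cancel)
  with Cons show ?case by (auto simp: word_inv_def x intro: pres_eq.trans)
qed

lemma group_presented_group: "group (presented_group R)"
proof (rule groupI)
  let ?G = "presented_group R"
  have carr: "\<exists>u. X = pres_rel R `` {u}" if "X \<in> carrier ?G" for X
    using that by (auto simp: presented_group_def elim: quotientE)
  have cls: "pres_rel R `` {u} \<in> carrier ?G" for u
    by (auto simp: presented_group_def intro: quotientI)
  have one: "\<one>\<^bsub>?G\<^esub> = pres_rel R `` {[]}" by (simp add: presented_group_def)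
  show "\<one>\<^bsub>?G\<^esub> \<in> carrier ?G" by (simp add: one cls)
  fix X assume "X \<in> carrier ?G"
  then obtain u where X: "X = pres_rel R `` {u}" using carr by blast
  show "\<one>\<^bsub>?G\<^esub> \<otimes>\<^bsub>?G\<^esub> X = X" by (simp add: one X presented_group_mult)
  have "pres_rel R `` {word_inv u @ u} = pres_rel R `` {[]}"
    by (intro equiv_class_eq[OF equiv_pres_rel]) (simp add: pres_rel_def pres_eq_word_inv)
  then show "\<exists>Y\<in>carrier ?G. Y \<otimes>\<^bsub>?G\<^esub> X = \<one>\<^bsub>?G\<^esub>"
    by (intro bexI[OF _ cls[of "word_inv u"]]) (simp add: X one presented_group_mult)
  fix Y assume "Y \<in> carrier ?G"
  then obtain v where Y: "Y = pres_rel R `` {v}" using carr by blast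
  show "X \<otimes>\<^bsub>?G\<^esub> Y \<in> carrier ?G" by (simp add: X Y presented_group_mult cls)
  fix Z assume "Z \<in> carrier ?G"
  then obtain w where Z: "Z = pres_rel R `` {w}" using carr by blast
  show "X \<otimes>\<^bsub>?G\<^esub> Y \<otimes>\<^bsub>?G\<^esub> Z = X \<otimes>\<^bsub>?G\<^esub> (Y \<otimes>\<^bsub>?G\<^esub> Z)"
    by (simp add: X Y Z presented_group_mult)
qed


section \<open>Baumslag--Solitar groups\<close>

datatype bs_gen = Gen_a | Gen_t

definition gen_pow :: "'g \<Rightarrow> int \<Rightarrow> 'g word" where
  "gen_pow g k = replicate (nat \<bar>k\<bar>) (g, k \<ge> 0)"

definition BS_relations :: "int \<Rightarrow> int \<Rightarrow> (bs_gen word \<times> bs_gen word) set" where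
  "BS_relations m n =
    {(gen_pow Gen_t 1 @ gen_pow Gen_a m @ gen_pow Gen_t (- 1), gen_pow Gen_a n)}"

definition BS :: "int \<Rightarrow> int \<Rightarrow> bs_gen word set monoid" where
  "BS m n = presented_group (BS_relations m n)"

definition BS_a :: "int \<Rightarrow> int \<Rightarrow> bs_gen word set" where
  "BS_a m n = pres_rel (BS_relations m n) `` {gen_pow Gen_a 1}"

lemma group_BS: "group (BS m n)"
  by (simp add: BS_def group_presented_group)

definition BS_cosets :: "int \<Rightarrow> int \<Rightarrow> bs_gen word set set set" where
  "BS_cosets m n = lcosets\<^bsub>BS m n\<^esub> (generate (BS m n) {BS_a m n})"

definition BS_action ::
    "int \<Rightarrow> int \<Rightarrow> bs_gen word set \<Rightarrow> (bs_gen word set set \<Rightarrow> bs_gen word set set)" where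
  "BS_action m n g = (\<lambda>C \<in> BS_cosets m n. g <#\<^bsub>BS m n\<^esub> C)"


section \<open>The topology of pointwise convergence on a symmetric group\<close>

text \<open>\<^const>\<open>Bij\<close> \<open>X\<close>, the carrier of \<^const>\<open>BijGroup\<close> \<open>X\<close>, consists of the bijections of \<open>X\<close>
  extended by \<^const>\<open>undefined\<close> outside \<open>X\<close>, which is also the convention for the points of
  \<^const>\<open>product_topology\<close>.\<close>

definition Sym_topology :: "'c set \<Rightarrow> ('c \<Rightarrow> 'c) topology" where
  "Sym_topology X = subtopology (product_topology (\<lambda>_. discrete_topology X) X) (Bij X)"

definition Sym_nbhd :: "'c set \<Rightarrow> ('c \<Rightarrow> 'c) \<Rightarrow> 'c set \<Rightarrow> ('c \<Rightarrow> 'c) set" where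
  "Sym_nbhd X x F = {y \<in> Bij X. \<forall>c\<in>F. y c = x c}"

lemma Bij_subset_PiE: "Bij X \<subseteq> (\<Pi>\<^sub>E c\<in>X. X)"
  by (auto simp: Bij_def PiE_def dest: bij_betwE)

lemma topspace_Sym_topology: "topspace (Sym_topology X) = Bij X"
  using Bij_subset_PiE[of X] by (auto simp: Sym_topology_def)

lemma openin_Sym_topology:
  "openin (Sym_topology X) U \<longleftrightarrow>
    U \<subseteq> Bij X \<and> (\<forall>x\<in>U. \<exists>F. finite F \<and> F \<subseteq> X \<and> Sym_nbhd X x F \<subseteq> U)"
    (is "?L \<longleftrightarrow> ?R")
proof
  assume L: ?L
  then obtain V where V: "openin (product_topology (\<lambda>_. discrete_topology X) X) V"
    and U: "U = V \<inter> Bij X"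
    by (auto simp: Sym_topology_def openin_subtopology)
  have "\<exists>F. finite F \<and> F \<subseteq> X \<and> Sym_nbhd X x F \<subseteq> U" if "x \<in> U" for x
  proof -
    from that U have "x \<in> V" by blast
    with V obtain W where W: "finite {i \<in> X. W i \<noteq> topspace (discrete_topology X)}"
        "x \<in> Pi\<^sub>E X W" "Pi\<^sub>E X W \<subseteq> V"
      unfolding openin_product_topology_alt by blast
    let ?F = "{i \<in> X. W i \<noteq> X}"
    have "Sym_nbhd X x ?F \<subseteq> U"
    proof
      fix y assume y: "y \<in> Sym_nbhd X x ?F"
      then have yB: "y \<in> Bij X" and yF: "\<And>c. c \<in> ?F \<Longrightarrow> y c = x c"
        by (auto simp: Sym_nbhd_def)
      have "y c \<in> W c" if "c \<in> X" for c
      proof (cases "W c = X")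
        case True
        then show ?thesis using yB that Bij_subset_PiE[of X] by blast
      next
        case False
        then show ?thesis using yF[of c] that W(2) by auto
      qed
      moreover have "y \<in> extensional X" using yB by (simp add: Bij_def)
      ultimately have "y \<in> Pi\<^sub>E X W" by (simp add: PiE_iff)
      then show "y \<in> U" using W(3) yB U by blast
    qed
    moreover have "finite ?F" using W(1) by simp
    ultimately show ?thesis by blast
  qed
  then show ?R using U by blast
next
  assume R: ?R
  have "\<exists>T. openin (Sym_topology X) T \<and> x \<in> T \<and> T \<subseteq> U" if x: "x \<in> U" for x
  proof -
    from R x obtain F where F: "finite F" "F \<subseteq> X" "Sym_nbhd X x F \<subseteq> U" by blast
    have xB: "x \<in> Bij X" using R x by blast
    let ?W = "\<lambda>c. if c \<in> F then {x c} else X"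
    have xX: "x c \<in> X" if "c \<in> X" for c using xB that Bij_subset_PiE[of X] by blast
    have "openin (product_topology (\<lambda>_. discrete_topology X) X) (Pi\<^sub>E X ?W)"
      using F xX
      by (intro product_topology_basis) (auto intro: finite_subset[OF _ F(1)])
    then have "openin (Sym_topology X) (Pi\<^sub>E X ?W \<inter> Bij X)"
      by (auto simp: Sym_topology_def openin_subtopology)
    moreover have "x \<in> Pi\<^sub>E X ?W \<inter> Bij X"
      using xB xX by (auto simp: PiE_iff Bij_def)
    moreover have "Pi\<^sub>E X ?W \<inter> Bij X \<subseteq> Sym_nbhd X x F"
    proof
      fix y assume y: "y \<in> Pi\<^sub>E X ?W \<inter> Bij X"
      then have "y c = x c" if "c \<in> F" for c
        using PiE_mem[of y X ?W c] that F(2) by auto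
      with y show "y \<in> Sym_nbhd X x F" by (simp add: Sym_nbhd_def)
    qed
    ultimately show ?thesis using F(3) by blast
  qed
  then show ?L by (subst openin_subopen) blast
qed


section \<open>The group \<open>G\<^bsub>m,n\<^esub>\<close>\<close>

definition GBS_carrier ::
    "int \<Rightarrow> int \<Rightarrow> (bs_gen word set set \<Rightarrow> bs_gen word set set) set" where
  "GBS_carrier m n =
    Sym_topology (BS_cosets m n) closure_of (BS_action m n ` carrier (BS m n))"

definition GBS :: "int \<Rightarrow> int \<Rightarrow> (bs_gen word set set \<Rightarrow> bs_gen word set set) monoid" where
  "GBS m n = (BijGroup (BS_cosets m n))\<lparr>carrier := GBS_carrier m n\<rparr>"

definition GBS_topology ::
    "int \<Rightarrow> int \<Rightarrow> (bs_gen word set set \<Rightarrow> bs_gen word set set) topology" where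
  "GBS_topology m n = subtopology (Sym_topology (BS_cosets m n)) (GBS_carrier m n)"


section \<open>The scale function\<close>

definition subgroup_index :: "('a, 'b) monoid_scheme \<Rightarrow> 'a set \<Rightarrow> 'a set \<Rightarrow> nat" where
  "subgroup_index G V W = card (lcosets\<^bsub>G\<lparr>carrier := V\<rparr>\<^esub> W)"

definition compact_open_subgroup ::
    "('a, 'b) monoid_scheme \<Rightarrow> 'a topology \<Rightarrow> 'a set \<Rightarrow> bool" where
  "compact_open_subgroup G T V \<longleftrightarrow> subgroup V G \<and> compactin T V \<and> openin T V"

text \<open>In a topological group, \<open>V \<inter> x\<inverse>Vx\<close> is an open subgroup of the compact group \<open>V\<close>, so all the
  indices below are finite and \<^const>\<open>card\<close> does not take its default value \<open>0\<close>.  The infimum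
  of a nonempty set of natural numbers is its minimum; compact open subgroups exist in every
  totally disconnected locally compact group.\<close>

definition tdlc_scale :: "('a, 'b) monoid_scheme \<Rightarrow> 'a topology \<Rightarrow> 'a \<Rightarrow> nat" where
  "tdlc_scale G T x =
    Inf {subgroup_index G V (V \<inter> (inv\<^bsub>G\<^esub> x <#\<^bsub>G\<^esub> V #>\<^bsub>G\<^esub> x)) |V. compact_open_subgroup G T V}"

end

theory Submission
  imports Defs
begin

text \<open>Write \<open>X\<close> for the set of cosets of \<open>\<langle>a\<rangle>\<close>, \<open>o\<close> for the coset \<open>\<langle>a\<rangle>\<close> itself, and
  \<open>V N\<close> for the closure of \<open>\<langle>a\<^sup>N\<rangle>\<close> in the symmetric group.  Let \<open>m = d m'\<close> and \<open>n = d n'\<close>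
  with \<open>d = gcd m n\<close>, so that \<open>lcm m n / \<bar>n\<bar> = \<bar>m'\<bar>\<close> and \<open>lcm m n / \<bar>m\<bar> = \<bar>n'\<bar>\<close>.  The exponent sum
  in \<open>t\<close> extends from the Baumslag--Solitar group to its closure, because it is constant on the
  cosets of \<open>\<langle>a\<rangle>\<close>, and the scale of an element depends only on its exponent sum \<open>\<rho>\<close>: it is
  \<open>\<bar>m'\<bar>\<^sup>\<rho>\<close> if \<open>\<rho> \<ge> 0\<close> and \<open>\<bar>n'\<bar>\<^sup>-\<^sup>\<rho>\<close> otherwise.  Every integer is the exponent sum of a power
  of \<open>t\<close>, so these are exactly the scales.

  The arithmetic input is the action of the group on the line by \<open>a(x) = x + 1\<close> and
  \<open>t(x) = (n / m) x\<close>.  It shows that \<open>a\<^sup>i g = g a\<^sup>j\<close> forces \<open>i = (n / m)\<^sup>\<rho> j\<close>, where \<open>\<rho>\<close> is the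
  exponent sum of \<open>g\<close>; and for every \<open>g\<close> such a relation with \<open>i \<noteq> 0\<close> exists, by induction on a
  word for \<open>g\<close>.  In particular the orbits of \<open>\<langle>a\<rangle>\<close> on \<open>X\<close> are finite, so each \<open>V N\<close> with
  \<open>N \<noteq> 0\<close> is a compact open subgroup.

  Upper bound (\<open>index_upper_bound\<close>): write \<open>x = g v\<close> with \<open>g\<close> in the Baumslag--Solitar group and \<open>v\<close>
  in \<open>V 1\<close>.  The group \<open>V 1\<close> is abelian, so \<open>x\<close> conjugates its elements as \<open>g\<close> does.  If
  \<open>a\<^sup>N g = g a\<^sup>K\<close> with \<open>N \<noteq> 0\<close>, then \<open>K = (m / n)\<^sup>\<rho> N\<close>, and \<open>V L\<close> lies in \<open>V N \<inter> x\<inverse> (V N) x\<close> for a common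
  multiple \<open>L\<close> of \<open>N\<close> and \<open>K\<close>, which can be chosen so that \<open>L / N\<close> is, up to sign, the asserted
  scale.

  Lower bound (\<open>orbit_growth_le_index\<close>): let \<open>V\<close> be any compact open subgroup and \<open>i\<close> the index of
  \<open>V \<inter> x\<inverse>Vx\<close> in \<open>V\<close>.  Then \<open>V x\<inverse> V\<close> is a union of \<open>i\<close> sets \<open>r x\<inverse> V\<close>, so the orbit of \<open>x\<^sup>-\<^sup>k o\<close> under
  \<open>V\<close> has size at most a constant times \<open>i\<^sup>k\<close>; by commensurability the same is true of the orbit
  under \<open>V 1\<close>.  But the affine action shows that the latter has at least \<open>s\<^sup>k\<close> points, where
  \<open>s\<close> is the asserted scale.  Hence \<open>s \<le> i\<close>.\<close>

section \<open>Permutation groups and their closures\<close>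

lemma carrier_BijGroup [simp]: "carrier (BijGroup X) = Bij X"
  by (simp add: BijGroup_def)

lemma BijGroup_mult_apply:
  assumes "y \<in> Bij X" "z \<in> Bij X" "c \<in> X"
  shows "(y \<otimes>\<^bsub>BijGroup X\<^esub> z) c = y (z c)"
  using assms by (simp add: BijGroup_def compose_def)

lemma BijGroup_one_apply: "c \<in> X \<Longrightarrow> \<one>\<^bsub>BijGroup X\<^esub> c = c"
  by (simp add: BijGroup_def)

lemma Bij_apply_closed: "y \<in> Bij X \<Longrightarrow> c \<in> X \<Longrightarrow> y c \<in> X"
  using Bij_imp_funcset by blast

lemma Bij_eqI:
  assumes "y \<in> Bij X" "z \<in> Bij X" "\<And>c. c \<in> X \<Longrightarrow> y c = z c"
  shows "y = z"
  using assms by (intro extensionalityI[of y X z]) (auto dest: Bij_imp_extensional)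

lemma Bij_inv_closed: "y \<in> Bij X \<Longrightarrow> inv\<^bsub>BijGroup X\<^esub> y \<in> Bij X"
  using group.inv_closed[OF group_BijGroup, of y X] by simp

lemma Bij_mult_closed:
  "y \<in> Bij X \<Longrightarrow> z \<in> Bij X \<Longrightarrow> y \<otimes>\<^bsub>BijGroup X\<^esub> z \<in> Bij X"
  using monoid.m_closed[OF group.is_monoid[OF group_BijGroup], of y X z] by simp

lemma BijGroup_inv_apply:
  assumes "y \<in> Bij X" "c \<in> X"
  shows "(inv\<^bsub>BijGroup X\<^esub> y) (y c) = c" "y ((inv\<^bsub>BijGroup X\<^esub> y) c) = c"
proof -
  interpret group "BijGroup X" by (rule group_BijGroup)
  have "(inv\<^bsub>BijGroup X\<^esub> y \<otimes>\<^bsub>BijGroup X\<^esub> y) c = c" "(y \<otimes>\<^bsub>BijGroup X\<^esub> inv\<^bsub>BijGroup X\<^esub> y) c = c"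
    using assms l_inv[of y] r_inv[of y] by (simp_all add: BijGroup_one_apply)
  then show "(inv\<^bsub>BijGroup X\<^esub> y) (y c) = c" "y ((inv\<^bsub>BijGroup X\<^esub> y) c) = c"
    using assms BijGroup_mult_apply[OF Bij_inv_closed assms]
      BijGroup_mult_apply[OF assms(1) Bij_inv_closed assms(2)] by metis+
qed

lemma Bij_apply_eq_iff: "y \<in> Bij X \<Longrightarrow> c \<in> X \<Longrightarrow> d \<in> X \<Longrightarrow> y c = y d \<longleftrightarrow> c = d"
  by (metis BijGroup_inv_apply(1))

text \<open>The closure is handled through this local approximation property, so that statements about
  it reduce to finite sets of points.\<close>

definition perm_closure :: "'c set \<Rightarrow> ('c \<Rightarrow> 'c) set \<Rightarrow> ('c \<Rightarrow> 'c) set" where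
  "perm_closure X P =
    {y \<in> Bij X. \<forall>F. finite F \<longrightarrow> F \<subseteq> X \<longrightarrow> (\<exists>g\<in>P. \<forall>c\<in>F. g c = y c)}"

lemma perm_closureD:
  assumes "y \<in> perm_closure X P" "finite F" "F \<subseteq> X"
  obtains g where "g \<in> P" "\<And>c. c \<in> F \<Longrightarrow> g c = y c"
  using assms by (auto simp: perm_closure_def)

lemma perm_closure_Bij: "y \<in> perm_closure X P \<Longrightarrow> y \<in> Bij X"
  by (simp add: perm_closure_def)

lemma perm_closure_superset: "P \<subseteq> Bij X \<Longrightarrow> P \<subseteq> perm_closure X P"
  by (auto simp: perm_closure_def)

lemma perm_closure_mono: "P \<subseteq> Q \<Longrightarrow> perm_closure X P \<subseteq> perm_closure X Q"
  unfolding perm_closure_def by blast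

lemma product_closure_iff:
  assumes "P \<subseteq> (\<Pi>\<^sub>E c\<in>X. X)"
  shows "y \<in> product_topology (\<lambda>_. discrete_topology X) X closure_of P \<longleftrightarrow>
    y \<in> (\<Pi>\<^sub>E c\<in>X. X) \<and> (\<forall>F. finite F \<longrightarrow> F \<subseteq> X \<longrightarrow> (\<exists>g\<in>P. \<forall>c\<in>F. g c = y c))"
    (is "y \<in> ?T closure_of P \<longleftrightarrow> _")
proof (intro iffI conjI allI impI)
  assume y: "y \<in> ?T closure_of P"
  then show yE: "y \<in> (\<Pi>\<^sub>E c\<in>X. X)" by (simp add: in_closure_of)
  fix F assume F: "finite F" "F \<subseteq> X"
  let ?W = "\<lambda>c. if c \<in> F then {y c} else X"
  have "openin ?T (Pi\<^sub>E X ?W)"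
    using F yE by (intro product_topology_basis) (auto intro: finite_subset[OF _ F(1)])
  moreover have "y \<in> Pi\<^sub>E X ?W" using yE by (auto simp: PiE_iff)
  ultimately obtain g where "g \<in> P" "g \<in> Pi\<^sub>E X ?W"
    using y by (auto simp: in_closure_of)
  moreover have "g c = y c" if "c \<in> F" for c
    using that F \<open>g \<in> Pi\<^sub>E X ?W\<close> PiE_mem[of g X ?W c] by auto
  ultimately show "\<exists>g\<in>P. \<forall>c\<in>F. g c = y c" by blast
next
  assume R: "y \<in> (\<Pi>\<^sub>E c\<in>X. X) \<and>
    (\<forall>F. finite F \<longrightarrow> F \<subseteq> X \<longrightarrow> (\<exists>g\<in>P. \<forall>c\<in>F. g c = y c))"
  have "\<exists>g\<in>P. g \<in> T" if T: "openin ?T T" "y \<in> T" for T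
  proof -
    obtain W where W: "finite {i \<in> X. W i \<noteq> topspace (discrete_topology X)}"
        "y \<in> Pi\<^sub>E X W" "Pi\<^sub>E X W \<subseteq> T"
      using T unfolding openin_product_topology_alt by blast
    let ?F = "{i \<in> X. W i \<noteq> X}"
    have "finite ?F" using W(1) by simp
    then obtain g where g: "g \<in> P" "\<And>c. c \<in> ?F \<Longrightarrow> g c = y c"
      using R by (metis (no_types, lifting) mem_Collect_eq subsetI)
    have "g c \<in> W c" if "c \<in> X" for c
    proof (cases "W c = X")
      case True
      then show ?thesis using g(1) assms that by blast
    next
      case False
      then show ?thesis using g(2)[of c] that W(2) by auto
    qed
    moreover have "g \<in> extensional X" using g(1) assms by (auto simp: PiE_def)
    ultimately have "g \<in> Pi\<^sub>E X W" by (simp add: PiE_iff)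
    then show ?thesis using W(3) g(1) by blast
  qed
  then show "y \<in> ?T closure_of P" using R by (force simp: in_closure_of)
qed

lemma Sym_closure_eq_perm_closure:
  assumes "P \<subseteq> Bij X"
  shows "Sym_topology X closure_of P = perm_closure X P"
proof -
  have "Bij X \<inter> P = P" using assms by blast
  then have "Sym_topology X closure_of P =
      Bij X \<inter> (product_topology (\<lambda>_. discrete_topology X) X closure_of P)"
    by (simp add: Sym_topology_def closure_of_subtopology)
  also have "\<dots> = perm_closure X P"
    using assms Bij_subset_PiE[of X]
    by (auto simp: perm_closure_def product_closure_iff[OF order.trans[OF assms Bij_subset_PiE]])
  finally show ?thesis .
qed

lemma subgroup_perm_closure:
  assumes "subgroup P (BijGroup X)"
  shows "subgroup (perm_closure X P) (BijGroup X)"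
proof -
  interpret group "BijGroup X" by (rule group_BijGroup)
  interpret P: subgroup P "BijGroup X" by fact
  have PB: "P \<subseteq> Bij X" using P.subset by simp
  show ?thesis
  proof
    show "perm_closure X P \<subseteq> carrier (BijGroup X)" by (auto simp: perm_closure_def)
    show "\<one>\<^bsub>BijGroup X\<^esub> \<in> perm_closure X P"
      using perm_closure_superset[OF PB] P.one_closed by blast
  next
    fix y z assume yz: "y \<in> perm_closure X P" "z \<in> perm_closure X P"
    then have B: "y \<in> Bij X" "z \<in> Bij X" by (auto dest: perm_closure_Bij)
    have "\<exists>g\<in>P. \<forall>c\<in>F. g c = (y \<otimes>\<^bsub>BijGroup X\<^esub> z) c" if F: "finite F" "F \<subseteq> X" for F
    proof -
      obtain h where h: "h \<in> P" "\<And>c. c \<in> F \<Longrightarrow> h c = z c"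
        using perm_closureD[OF yz(2) F] by blast
      have "finite (z ` F)" "z ` F \<subseteq> X" using F Bij_apply_closed[OF B(2)] by auto
      then obtain g where g: "g \<in> P" "\<And>c. c \<in> z ` F \<Longrightarrow> g c = y c"
        using perm_closureD[OF yz(1)] by metis
      have "(g \<otimes>\<^bsub>BijGroup X\<^esub> h) c = (y \<otimes>\<^bsub>BijGroup X\<^esub> z) c" if "c \<in> F" for c
        using that F g h PB B by (subst (1 2) BijGroup_mult_apply) auto
      then show ?thesis using P.m_closed[OF g(1) h(1)] by blast
    qed
    then show "y \<otimes>\<^bsub>BijGroup X\<^esub> z \<in> perm_closure X P"
      using Bij_mult_closed[OF B] by (auto simp: perm_closure_def)
  next
    fix y assume y: "y \<in> perm_closure X P"
    then have B: "y \<in> Bij X" "inv\<^bsub>BijGroup X\<^esub> y \<in> Bij X"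
      by (auto dest: perm_closure_Bij intro: Bij_inv_closed)
    have "\<exists>g\<in>P. \<forall>c\<in>F. g c = (inv\<^bsub>BijGroup X\<^esub> y) c" if F: "finite F" "F \<subseteq> X" for F
    proof -
      let ?F = "(inv\<^bsub>BijGroup X\<^esub> y) ` F"
      have "finite ?F" "?F \<subseteq> X" using F Bij_apply_closed[OF B(2)] by auto
      then obtain g where g: "g \<in> P" "\<And>c. c \<in> ?F \<Longrightarrow> g c = y c"
        using perm_closureD[OF y] by metis
      have "(inv\<^bsub>BijGroup X\<^esub> g) c = (inv\<^bsub>BijGroup X\<^esub> y) c" if "c \<in> F" for c
      proof -
        have cX: "c \<in> X" using that F by auto
        then have d: "(inv\<^bsub>BijGroup X\<^esub> y) c \<in> X" using Bij_apply_closed[OF B(2)] by blast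
        have "g ((inv\<^bsub>BijGroup X\<^esub> y) c) = c"
          using g(2) that BijGroup_inv_apply(2)[OF B(1) cX] by auto
        moreover have "g \<in> Bij X" using g(1) PB by blast
        ultimately show ?thesis using BijGroup_inv_apply(1)[OF _ d, of g] by simp
      qed
      then show ?thesis using P.m_inv_closed[OF g(1)] by blast
    qed
    then show "inv\<^bsub>BijGroup X\<^esub> y \<in> perm_closure X P"
      using B by (auto simp: perm_closure_def)
  qed
qed

text \<open>Conjugation is continuous.\<close>

lemma perm_closure_conj:
  assumes PQ: "\<And>p. p \<in> P \<Longrightarrow> g \<otimes>\<^bsub>BijGroup X\<^esub> p \<otimes>\<^bsub>BijGroup X\<^esub> inv\<^bsub>BijGroup X\<^esub> g \<in> Q"
    and "P \<subseteq> Bij X" and g: "g \<in> Bij X" and y: "y \<in> perm_closure X P"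
  shows "g \<otimes>\<^bsub>BijGroup X\<^esub> y \<otimes>\<^bsub>BijGroup X\<^esub> inv\<^bsub>BijGroup X\<^esub> g \<in> perm_closure X Q"
proof -
  let ?i = "inv\<^bsub>BijGroup X\<^esub> g"
  have B: "y \<in> Bij X" "?i \<in> Bij X"
    using y g by (auto dest: perm_closure_Bij intro: Bij_inv_closed)
  have app: "(g \<otimes>\<^bsub>BijGroup X\<^esub> p \<otimes>\<^bsub>BijGroup X\<^esub> ?i) c = g (p (?i c))" if "p \<in> Bij X" "c \<in> X" for p c
    using that g B Bij_apply_closed[OF B(2)] by (simp add: BijGroup_mult_apply Bij_mult_closed)
  have "\<exists>q\<in>Q. \<forall>c\<in>F. q c = (g \<otimes>\<^bsub>BijGroup X\<^esub> y \<otimes>\<^bsub>BijGroup X\<^esub> ?i) c"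
    if F: "finite F" "F \<subseteq> X" for F
  proof -
    have "finite (?i ` F)" "?i ` F \<subseteq> X" using F Bij_apply_closed[OF B(2)] by auto
    then obtain p where p: "p \<in> P" "\<And>c. c \<in> ?i ` F \<Longrightarrow> p c = y c"
      using perm_closureD[OF y] by metis
    have "(g \<otimes>\<^bsub>BijGroup X\<^esub> p \<otimes>\<^bsub>BijGroup X\<^esub> ?i) c = (g \<otimes>\<^bsub>BijGroup X\<^esub> y \<otimes>\<^bsub>BijGroup X\<^esub> ?i) c"
      if "c \<in> F" for c
    proof -
      have "c \<in> X" "p \<in> Bij X" "p (?i c) = y (?i c)" using that F p assms(2) by auto
      then show ?thesis using app[of p c] app[of y c] B(1) by simp
    qed
    then show ?thesis using PQ[OF p(1)] by blast
  qed
  then show ?thesis using B g by (auto simp: perm_closure_def intro: Bij_mult_closed)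
qed

text \<open>A finite union of closed sets is closed.\<close>

lemma perm_closure_finite_Union:
  assumes "finite I" and y: "y \<in> perm_closure X (\<Union>i\<in>I. Q i)"
  shows "\<exists>i\<in>I. y \<in> perm_closure X (Q i)"
proof (rule ccontr)
  assume "\<not> ?thesis"
  then have "\<forall>i\<in>I. \<exists>F. finite F \<and> F \<subseteq> X \<and> (\<forall>g\<in>Q i. \<exists>c\<in>F. g c \<noteq> y c)"
    using y by (fastforce simp: perm_closure_def)
  then obtain F where F: "\<And>i. i \<in> I \<Longrightarrow> finite (F i) \<and> F i \<subseteq> X \<and> (\<forall>g\<in>Q i. \<exists>c\<in>F i. g c \<noteq> y c)"
    by metis
  have "finite (\<Union>i\<in>I. F i)" "(\<Union>i\<in>I. F i) \<subseteq> X" using F assms(1) by auto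
  then obtain g where "g \<in> (\<Union>i\<in>I. Q i)" "\<And>c. c \<in> (\<Union>i\<in>I. F i) \<Longrightarrow> g c = y c"
    using perm_closureD[OF y] by metis
  then show False using F by blast
qed

lemma perm_closure_translate:
  assumes Q: "Q \<subseteq> Bij X" and g: "g \<in> Bij X"
    and y: "y \<in> perm_closure X ((\<lambda>q. g \<otimes>\<^bsub>BijGroup X\<^esub> q) ` Q)"
  shows "inv\<^bsub>BijGroup X\<^esub> g \<otimes>\<^bsub>BijGroup X\<^esub> y \<in> perm_closure X Q"
proof -
  let ?i = "inv\<^bsub>BijGroup X\<^esub> g"
  have B: "y \<in> Bij X" "?i \<in> Bij X"
    using y g by (auto dest: perm_closure_Bij intro: Bij_inv_closed)
  have "\<exists>q\<in>Q. \<forall>c\<in>F. q c = (?i \<otimes>\<^bsub>BijGroup X\<^esub> y) c" if F: "finite F" "F \<subseteq> X" for F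
  proof -
    obtain q where q: "q \<in> Q" "\<And>c. c \<in> F \<Longrightarrow> (g \<otimes>\<^bsub>BijGroup X\<^esub> q) c = y c"
      using perm_closureD[OF y F] by blast
    have qB: "q \<in> Bij X" using q(1) Q by blast
    have "q c = (?i \<otimes>\<^bsub>BijGroup X\<^esub> y) c" if "c \<in> F" for c
    proof -
      have "c \<in> X" using that F by auto
      moreover from this have "g (q c) = y c"
        using q(2)[OF that] g qB by (simp add: BijGroup_mult_apply)
      ultimately show ?thesis
        using BijGroup_inv_apply(1)[OF g Bij_apply_closed[OF qB, of c]] B
        by (simp add: BijGroup_mult_apply)
    qed
    then show ?thesis using q(1) by blast
  qed
  then show ?thesis using B by (auto simp: perm_closure_def intro: Bij_mult_closed)
qed

lemma perm_closure_cosets: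
  assumes Q: "Q \<subseteq> Bij X" and I: "finite I" "I \<subseteq> Bij X"
    and P: "P \<subseteq> (\<Union>g\<in>I. (\<lambda>q. g \<otimes>\<^bsub>BijGroup X\<^esub> q) ` Q)"
    and y: "y \<in> perm_closure X P"
  obtains g where "g \<in> I" "inv\<^bsub>BijGroup X\<^esub> g \<otimes>\<^bsub>BijGroup X\<^esub> y \<in> perm_closure X Q"
proof -
  have "y \<in> perm_closure X (\<Union>g\<in>I. (\<lambda>q. g \<otimes>\<^bsub>BijGroup X\<^esub> q) ` Q)"
    using perm_closure_mono[OF P] y by blast
  then obtain g where "g \<in> I" "y \<in> perm_closure X ((\<lambda>q. g \<otimes>\<^bsub>BijGroup X\<^esub> q) ` Q)"
    using perm_closure_finite_Union[OF I(1)] by metis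
  then show thesis using that perm_closure_translate[OF Q, of g y] I by blast
qed

text \<open>A closed subgroup of finite index is open: the cosets that do not contain the identity
  are finitely many closed sets, so some finite set of points separates the identity from them.\<close>

lemma perm_closure_finite_index_open:
  assumes Q: "subgroup Q (BijGroup X)" and I: "finite I" "I \<subseteq> Bij X"
    and P: "P \<subseteq> (\<Union>g\<in>I. (\<lambda>q. g \<otimes>\<^bsub>BijGroup X\<^esub> q) ` Q)"
  obtains F where "finite F" "F \<subseteq> X"
    "\<And>y. y \<in> perm_closure X P \<Longrightarrow> (\<And>c. c \<in> F \<Longrightarrow> y c = c) \<Longrightarrow> y \<in> perm_closure X Q"
proof -
  interpret group "BijGroup X" by (rule group_BijGroup)
  interpret Q: subgroup "perm_closure X Q" "BijGroup X" by (rule subgroup_perm_closure[OF Q])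
  have QB: "Q \<subseteq> Bij X" using subgroup.subset[OF Q] by simp
  let ?gQ = "\<lambda>g. (\<lambda>q. g \<otimes>\<^bsub>BijGroup X\<^esub> q) ` Q"
  let ?id = "\<one>\<^bsub>BijGroup X\<^esub>"
  have idB: "?id \<in> Bij X" using one_closed by simp
  define J where "J = {g \<in> I. ?id \<notin> perm_closure X (?gQ g)}"
  have "\<forall>g\<in>J. \<exists>F. finite F \<and> F \<subseteq> X \<and> (\<forall>h\<in>?gQ g. \<exists>c\<in>F. h c \<noteq> ?id c)"
    using idB unfolding J_def perm_closure_def by fastforce
  then obtain F where F: "\<And>g. g \<in> J \<Longrightarrow>
      finite (F g) \<and> F g \<subseteq> X \<and> (\<forall>h\<in>?gQ g. \<exists>c\<in>F g. h c \<noteq> ?id c)"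
    by metis
  show thesis
  proof
    show "finite (\<Union>g\<in>J. F g)" "(\<Union>g\<in>J. F g) \<subseteq> X" using F I(1) by (auto simp: J_def)
    fix y assume y: "y \<in> perm_closure X P" and fixF: "\<And>c. c \<in> (\<Union>g\<in>J. F g) \<Longrightarrow> y c = c"
    have "y \<in> perm_closure X (\<Union>g\<in>I. ?gQ g)" using perm_closure_mono[OF P] y by blast
    then obtain g where g: "g \<in> I" "y \<in> perm_closure X (?gQ g)"
      using perm_closure_finite_Union[OF I(1)] by metis
    have gB: "g \<in> Bij X" using g(1) I by blast
    have "g \<notin> J"
    proof
      assume "g \<in> J"
      with F obtain h where h: "h \<in> ?gQ g" "\<And>c. c \<in> F g \<Longrightarrow> h c = y c"
        using perm_closureD[OF g(2)] by metis
      then show False using F[OF \<open>g \<in> J\<close>] fixF \<open>g \<in> J\<close> by (metis BijGroup_one_apply UN_I subsetD)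
    qed
    then have "?id \<in> perm_closure X (?gQ g)" using g by (simp add: J_def)
    then have "inv\<^bsub>BijGroup X\<^esub> g \<in> perm_closure X Q"
      using perm_closure_translate[OF QB gB, of ?id] r_one[OF inv_closed, of g] gB by simp
    moreover have "inv\<^bsub>BijGroup X\<^esub> g \<otimes>\<^bsub>BijGroup X\<^esub> y \<in> perm_closure X Q"
      using perm_closure_translate[OF QB gB g(2)] .
    ultimately have "g \<otimes>\<^bsub>BijGroup X\<^esub> (inv\<^bsub>BijGroup X\<^esub> g \<otimes>\<^bsub>BijGroup X\<^esub> y) \<in> perm_closure X Q"
      using Q.m_closed Q.m_inv_closed gB by (metis carrier_BijGroup inv_inv)
    then show "y \<in> perm_closure X Q"
      using gB perm_closure_Bij[OF y] by (simp add: m_assoc[symmetric] Bij_inv_closed)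
  qed
qed

text \<open>By Tychonoff's theorem the product of the orbits is compact.  A limit of permutations with
  finite orbits maps each orbit injectively into itself, hence onto, so no limit point of the
  group in the product fails to be a permutation.\<close>

lemma compactin_perm_closure:
  assumes P: "subgroup P (BijGroup X)" and fin: "\<And>c. c \<in> X \<Longrightarrow> finite ((\<lambda>g. g c) ` P)"
  shows "compactin (Sym_topology X) (perm_closure X P)"
proof -
  let ?T = "product_topology (\<lambda>_. discrete_topology X) X"
  let ?O = "\<lambda>c. (\<lambda>g. g c) ` P"
  interpret P: subgroup P "BijGroup X" by fact
  have PB: "P \<subseteq> Bij X" using P.subset by simp
  then have PE: "P \<subseteq> (\<Pi>\<^sub>E c\<in>X. X)" using Bij_subset_PiE by blast
  have OX: "?O c \<subseteq> X" if "c \<in> X" for c using that PE by auto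
  have Oself: "c \<in> ?O c" if "c \<in> X" for c
    using P.one_closed BijGroup_one_apply[OF that] by (metis imageI)
  have Otrans: "?O d \<subseteq> ?O c" if "d \<in> ?O c" "c \<in> X" for c d
  proof
    fix e assume "e \<in> ?O d"
    then obtain g where g: "g \<in> P" "e = g d" by blast
    obtain h where h: "h \<in> P" "d = h c" using \<open>d \<in> ?O c\<close> by blast
    have "e = (g \<otimes>\<^bsub>BijGroup X\<^esub> h) c"
      using g h that PB by (subst BijGroup_mult_apply) auto
    then show "e \<in> ?O c" using P.m_closed[OF g(1) h(1)] by (metis imageI)
  qed
  have eq: "?T closure_of P = perm_closure X P"
  proof (rule Set.set_eqI)
    fix y
    have "y \<in> Bij X" if yE: "y \<in> (\<Pi>\<^sub>E c\<in>X. X)"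
      and ap: "\<And>F. finite F \<Longrightarrow> F \<subseteq> X \<Longrightarrow> \<exists>g\<in>P. \<forall>c\<in>F. g c = y c"
    proof -
      have inj: "inj_on y X"
      proof (rule inj_onI)
        fix c d assume cd: "c \<in> X" "d \<in> X" "y c = y d"
        then obtain g where "g \<in> P" "g c = y c" "g d = y d" using ap[of "{c, d}"] by auto
        then show "c = d" using cd PB Bij_apply_eq_iff[of g X c d] by auto
      qed
      have "c \<in> y ` X" if c: "c \<in> X" for c
      proof -
        have "y d \<in> ?O c" if "d \<in> ?O c" for d
        proof -
          have "d \<in> X" using that OX[OF c] by blast
          then obtain g where "g \<in> P" "g d = y d" using ap[of "{d}"] by auto
          then show ?thesis using Otrans[OF that c] by (metis image_eqI subsetD)
        qed
        then have "y ` ?O c \<subseteq> ?O c" by blast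
        moreover have "inj_on y (?O c)" using inj OX[OF c] by (rule inj_on_subset)
        ultimately have "y ` ?O c = ?O c" using fin[OF c] by (simp add: endo_inj_surj)
        then show ?thesis using Oself[OF c] OX[OF c] by blast
      qed
      then have "y ` X = X" using yE by auto
      then show ?thesis using inj yE by (auto simp: Bij_def bij_betw_def PiE_def)
    qed
    then show "y \<in> ?T closure_of P \<longleftrightarrow> y \<in> perm_closure X P"
      using product_closure_iff[OF PE, of y] Bij_subset_PiE[of X]
      by (auto simp: perm_closure_def)
  qed
  have "compactin ?T (Pi\<^sub>E X ?O)"
    using fin OX by (simp add: compactin_PiE compactin_discrete_topology)
  moreover have "perm_closure X P \<subseteq> Pi\<^sub>E X ?O"
  proof
    fix y assume y: "y \<in> perm_closure X P"
    have "y c \<in> ?O c" if "c \<in> X" for c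
      using perm_closureD[OF y, of "{c}"] that by (metis empty_subsetI finite.simps image_eqI insert_subset singletonI)
    then show "y \<in> Pi\<^sub>E X ?O"
      using perm_closure_Bij[OF y] by (auto simp: PiE_iff Bij_def)
  qed
  moreover have "closedin ?T (perm_closure X P)" using closedin_closure_of[of ?T P] eq by simp
  ultimately have "compactin ?T (perm_closure X P)" by (metis closed_compactin)
  moreover have "perm_closure X P \<subseteq> Bij X" by (auto simp: perm_closure_def)
  ultimately show ?thesis by (simp add: Sym_topology_def compactin_subtopology)
qed

section \<open>Bounding the scale by the growth of orbits\<close>

lemma finite_image_factor:
  assumes "finite (g ` V)" "\<And>v v'. v \<in> V \<Longrightarrow> v' \<in> V \<Longrightarrow> g v = g v' \<Longrightarrow> f v = f v'"
  shows "finite (f ` V)"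
proof -
  have "f v \<in> (\<lambda>z. f (SOME w. w \<in> V \<and> g w = z)) ` g ` V" if "v \<in> V" for v
  proof -
    have "\<exists>w. w \<in> V \<and> g w = g v" using that by blast
    then have "(SOME w. w \<in> V \<and> g w = g v) \<in> V \<and> g (SOME w. w \<in> V \<and> g w = g v) = g v"
      by (rule someI_ex)
    then have "f v = f (SOME w. w \<in> V \<and> g w = g v)" using assms(2) that by metis
    then show ?thesis using that by blast
  qed
  then show ?thesis using assms(1) by (meson finite_imageI finite_subset image_subsetI)
qed

lemma (in group) lcoset_eqI:
  assumes "subgroup W G" "v \<in> carrier G" "v' \<in> carrier G" "inv v \<otimes> v' \<in> W"
  shows "v <# W = v' <# W"
proof -
  interpret W: subgroup W G by fact
  have "v' \<in> v <# W" using assms W.lcos_module_rev[OF is_group] by blast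
  then show ?thesis using assms(1,2) by (metis l_repr_independence)
qed

lemma (in group) inv_cancel_left:
  assumes "x \<in> carrier G" "y \<in> carrier G"
  shows "x \<otimes> (inv x \<otimes> y) = y" "inv x \<otimes> (x \<otimes> y) = y"
  using assms by (simp_all add: m_assoc[symmetric])

lemma (in group) Int_conj_eq:
  assumes "subgroup V G" "x \<in> carrier G"
  shows "V \<inter> (inv x <# V #> x) = {v \<in> V. x \<otimes> v \<otimes> inv x \<in> V}"
proof (intro equalityI subsetI)
  interpret V: subgroup V G by fact
  fix v assume "v \<in> V \<inter> (inv x <# V #> x)"
  then obtain w where w: "v \<in> V" "w \<in> V" "v = inv x \<otimes> w \<otimes> x"
    by (auto simp: l_coset_def r_coset_def)
  have "x \<otimes> v \<otimes> inv x = w"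
    using w assms V.mem_carrier by (simp add: m_assoc inv_cancel_left)
  then show "v \<in> {v \<in> V. x \<otimes> v \<otimes> inv x \<in> V}" using w by simp
next
  interpret V: subgroup V G by fact
  fix v assume v: "v \<in> {v \<in> V. x \<otimes> v \<otimes> inv x \<in> V}"
  then have "v = inv x \<otimes> (x \<otimes> v \<otimes> inv x) \<otimes> x"
    using assms V.mem_carrier by (simp add: m_assoc inv_cancel_left)
  then show "v \<in> V \<inter> (inv x <# V #> x)" using v by (auto simp: l_coset_def r_coset_def)
qed

lemma (in group) subgroup_Int_conj:
  assumes "subgroup V G" "x \<in> carrier G"
  shows "subgroup {v \<in> V. x \<otimes> v \<otimes> inv x \<in> V} G"
proof -
  interpret V: subgroup V G by fact
  show ?thesis
  proof
    show "{v \<in> V. x \<otimes> v \<otimes> inv x \<in> V} \<subseteq> carrier G" using V.subset by blast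
    show "\<one> \<in> {v \<in> V. x \<otimes> v \<otimes> inv x \<in> V}" using assms by simp
  next
    fix v w assume v: "v \<in> {v \<in> V. x \<otimes> v \<otimes> inv x \<in> V}" and w: "w \<in> {v \<in> V. x \<otimes> v \<otimes> inv x \<in> V}"
    have "x \<otimes> (v \<otimes> w) \<otimes> inv x = (x \<otimes> v \<otimes> inv x) \<otimes> (x \<otimes> w \<otimes> inv x)"
      using v w assms V.mem_carrier by (simp add: m_assoc inv_cancel_left)
    then show "v \<otimes> w \<in> {v \<in> V. x \<otimes> v \<otimes> inv x \<in> V}"
      using v w by (simp add: V.m_closed)
  next
    fix v assume v: "v \<in> {v \<in> V. x \<otimes> v \<otimes> inv x \<in> V}"
    have "x \<otimes> inv v \<otimes> inv x = inv (x \<otimes> v \<otimes> inv x)"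
      using v assms V.mem_carrier by (simp add: inv_mult_group m_assoc)
    then show "inv v \<in> {v \<in> V. x \<otimes> v \<otimes> inv x \<in> V}"
      using v by (simp add: V.m_inv_closed)
  qed
qed

text \<open>A coset \<open>v W\<close> is determined by the values of \<open>v\<close> on \<open>F\<close>, and finite orbits leave only finitely
  many possibilities for these values.\<close>

lemma finite_lcosets_of_fixator:
  assumes V: "subgroup V (BijGroup X)" and W: "subgroup W (BijGroup X)"
    and fin: "\<And>c. c \<in> X \<Longrightarrow> finite ((\<lambda>v. v c) ` V)"
    and F: "finite F" "F \<subseteq> X" "\<And>v. v \<in> V \<Longrightarrow> (\<And>c. c \<in> F \<Longrightarrow> v c = c) \<Longrightarrow> v \<in> W"
  shows "finite ((\<lambda>v. v <#\<^bsub>BijGroup X\<^esub> W) ` V)"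
proof (rule finite_image_factor[where g = "\<lambda>v. restrict v F"])
  interpret group "BijGroup X" by (rule group_BijGroup)
  interpret V: subgroup V "BijGroup X" by fact
  have "(\<lambda>v. restrict v F) ` V \<subseteq> (\<Pi>\<^sub>E c\<in>F. (\<lambda>v. v c) ` V)" by auto
  moreover have "finite (\<Pi>\<^sub>E c\<in>F. (\<lambda>v. v c) ` V)"
    using F fin by (intro finite_PiE) auto
  ultimately show "finite ((\<lambda>v. restrict v F) ` V)" by (rule finite_subset)
  fix v v' assume v: "v \<in> V" "v' \<in> V" and eq: "restrict v F = restrict v' F"
  then have B: "v \<in> Bij X" "v' \<in> Bij X" using V.subset by auto
  have "(inv\<^bsub>BijGroup X\<^esub> v \<otimes>\<^bsub>BijGroup X\<^esub> v') c = c" if c: "c \<in> F" for c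
  proof -
    have "c \<in> X" using F(2) c by blast
    moreover have "v' c = v c" using fun_cong[OF eq, of c] c by simp
    ultimately show ?thesis
      using BijGroup_mult_apply[OF Bij_inv_closed[OF B(1)] B(2)] BijGroup_inv_apply(1)[OF B(1)]
      by metis
  qed
  then have "inv\<^bsub>BijGroup X\<^esub> v \<otimes>\<^bsub>BijGroup X\<^esub> v' \<in> W" using F(3) v by simp
  then show "v <#\<^bsub>BijGroup X\<^esub> W = v' <#\<^bsub>BijGroup X\<^esub> W"
    using W B by (intro lcoset_eqI) auto
qed

lemma lcoset_representatives:
  fixes G (structure)
  assumes "group G" "subgroup W G" "V \<subseteq> carrier G" "finite ((\<lambda>v. v <#\<^bsub>G\<^esub> W) ` V)"
  obtains R where "R \<subseteq> V" "finite R" "card R = card ((\<lambda>v. v <#\<^bsub>G\<^esub> W) ` V)"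
    "\<And>v. v \<in> V \<Longrightarrow> \<exists>r\<in>R. \<exists>w\<in>W. v = r \<otimes> w"
proof -
  let ?f = "\<lambda>v. v <#\<^bsub>G\<^esub> W"
  obtain R where R: "R \<subseteq> V" "inj_on ?f R" "?f ` V = ?f ` R"
    using subset_image_inj[of "?f ` V" ?f V] by (metis order_refl)
  have rep: "\<exists>r\<in>R. \<exists>w\<in>W. v = r \<otimes> w" if "v \<in> V" for v
  proof -
    have "v \<in> ?f v" using group.lcos_self[OF assms(1) _ assms(2)] that assms(3) by blast
    moreover have "?f v \<in> ?f ` R" using that by (simp flip: R(3))
    then obtain r where "r \<in> R" "?f v = ?f r" by (elim imageE)
    ultimately show ?thesis by (auto simp: l_coset_def)
  qed
  have "finite R" using assms(4) R(3) finite_imageD[OF _ R(2)] by metis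
  moreover have "card R = card (?f ` V)" using R(3) card_image[OF R(2)] by metis
  ultimately show thesis using that[OF R(1) _ _ rep] by metis
qed

text \<open>If \<open>r\<close> runs through representatives of \<open>V / (V \<inter> x\<inverse>Vx)\<close>, then \<open>V x\<inverse> V\<close> is the union of
  the sets \<open>r x\<inverse> V\<close>.  So applying \<open>V x\<inverse>\<close> to a \<open>V\<close>-invariant set multiplies its size by at most
  the index.\<close>

lemma invariant_set_growth:
  assumes V: "subgroup V (BijGroup X)" and x: "x \<in> Bij X"
    and W: "W = {v \<in> V. x \<otimes>\<^bsub>BijGroup X\<^esub> v \<otimes>\<^bsub>BijGroup X\<^esub> inv\<^bsub>BijGroup X\<^esub> x \<in> V}"
    and fin: "finite ((\<lambda>v. v <#\<^bsub>BijGroup X\<^esub> W) ` V)"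
    and S: "finite S" "S \<subseteq> X" "\<forall>v\<in>V. v ` S \<subseteq> S"
  shows "\<exists>S'. finite S' \<and> S' \<subseteq> X \<and> (\<forall>v\<in>V. v ` S' \<subseteq> S') \<and>
    (\<forall>c\<in>S. (inv\<^bsub>BijGroup X\<^esub> x) c \<in> S') \<and>
    card S' \<le> card ((\<lambda>v. v <#\<^bsub>BijGroup X\<^esub> W) ` V) * card S"
proof -
  interpret group "BijGroup X" by (rule group_BijGroup)
  interpret V: subgroup V "BijGroup X" by fact
  let ?i = "inv\<^bsub>BijGroup X\<^esub> x"
  have iB: "?i \<in> Bij X" using x by (rule Bij_inv_closed)
  have VB: "v \<in> Bij X" if "v \<in> V" for v using that V.subset by auto
  define S' where "S' = (\<Union>v\<in>V. (\<lambda>c. v (?i c)) ` S)"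
  have SW: "subgroup W (BijGroup X)" unfolding W by (rule subgroup_Int_conj[OF V]) (use x in simp)
  obtain R where R: "R \<subseteq> V" "finite R" "card R = card ((\<lambda>v. v <#\<^bsub>BijGroup X\<^esub> W) ` V)"
      "\<And>v. v \<in> V \<Longrightarrow> \<exists>r\<in>R. \<exists>w\<in>W. v = r \<otimes>\<^bsub>BijGroup X\<^esub> w"
    by (rule lcoset_representatives[OF group_BijGroup SW V.subset fin]) (rule that)
  have sub: "S' \<subseteq> (\<Union>r\<in>R. (\<lambda>c. r (?i c)) ` S)"
  proof
    fix d assume "d \<in> S'"
    then obtain v c where vc: "v \<in> V" "c \<in> S" "d = v (?i c)" by (auto simp: S'_def)
    then obtain r w where rw: "r \<in> R" "w \<in> W" "v = r \<otimes>\<^bsub>BijGroup X\<^esub> w" using R(4) by blast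
    have B: "r \<in> Bij X" "w \<in> Bij X" using rw R(1) VB W by auto
    let ?w = "x \<otimes>\<^bsub>BijGroup X\<^esub> w \<otimes>\<^bsub>BijGroup X\<^esub> ?i"
    have cX: "c \<in> X" using vc S by auto
    then have icX: "?i c \<in> X" by (rule Bij_apply_closed[OF iB])
    have "?w c = x (w (?i c))"
      using B x iB cX icX by (simp add: BijGroup_mult_apply Bij_mult_closed)
    moreover have "?w \<in> V" using rw(2) W by simp
    then have "?w ` S \<subseteq> S" by (rule bspec[OF S(3)])
    then have "?w c \<in> S" using vc(2) by (rule subsetD[OF _ imageI])
    ultimately have "w (?i c) \<in> ?i ` S"
      using BijGroup_inv_apply(1)[OF x Bij_apply_closed[OF B(2) icX]] by (metis imageI)
    then have "d \<in> r ` ?i ` S"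
      using vc(3) rw(3) BijGroup_mult_apply[OF B icX] by simp
    then show "d \<in> (\<Union>r\<in>R. (\<lambda>c. r (?i c)) ` S)" using rw(1) by blast
  qed
  have fU: "finite (\<Union>r\<in>R. (\<lambda>c. r (?i c)) ` S)" using R(2) S(1) by blast
  show ?thesis
  proof (intro exI[of _ S'] conjI ballI)
    show "finite S'" using sub fU by (rule finite_subset)
    show "S' \<subseteq> X"
    proof
      fix d assume "d \<in> S'"
      then obtain v c where vc: "v \<in> V" "c \<in> S" "d = v (?i c)" by (auto simp: S'_def)
      have "c \<in> X" using vc(2) S(2) by blast
      then show "d \<in> X" unfolding vc(3)
        by (rule Bij_apply_closed[OF VB[OF vc(1)] Bij_apply_closed[OF iB]])
    qed
    show "?i c \<in> S'" if "c \<in> S" for c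
    proof -
      have "c \<in> X" using that S(2) by blast
      then have "?i c \<in> X" by (rule Bij_apply_closed[OF iB])
      then have "\<one>\<^bsub>BijGroup X\<^esub> (?i c) = ?i c" by (rule BijGroup_one_apply)
      then show ?thesis using that V.one_closed unfolding S'_def
        by (intro UN_I[of "\<one>\<^bsub>BijGroup X\<^esub>"] image_eqI[of _ _ c]) simp_all
    qed
    show "u ` S' \<subseteq> S'" if "u \<in> V" for u
    proof (rule image_subsetI)
      fix d assume "d \<in> S'"
      then obtain v c where vc: "v \<in> V" "c \<in> S" "d = v (?i c)" by (auto simp: S'_def)
      then have "c \<in> X" using S(2) by blast
      then have "?i c \<in> X" by (rule Bij_apply_closed[OF iB])
      then have "u d = (u \<otimes>\<^bsub>BijGroup X\<^esub> v) (?i c)"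
        using vc that VB by (simp add: BijGroup_mult_apply)
      then show "u d \<in> S'" using V.m_closed[OF that vc(1)] vc(2) unfolding S'_def
        by (intro UN_I image_eqI) simp_all
    qed
    have "card S' \<le> card (\<Union>r\<in>R. (\<lambda>c. r (?i c)) ` S)" using fU sub by (rule card_mono)
    also have "\<dots> \<le> (\<Sum>r\<in>R. card ((\<lambda>c. r (?i c)) ` S))" using R(2) by (rule card_UN_le)
    also have "\<dots> \<le> (\<Sum>r\<in>R. card S)" using S(1) by (intro sum_mono card_image_le)
    finally show "card S' \<le> card ((\<lambda>v. v <#\<^bsub>BijGroup X\<^esub> W) ` V) * card S"
      using R(3) by simp
  qed
qed

lemma invariant_set_growth_iterate:
  assumes V: "subgroup V (BijGroup X)" and x: "x \<in> Bij X"
    and W: "W = {v \<in> V. x \<otimes>\<^bsub>BijGroup X\<^esub> v \<otimes>\<^bsub>BijGroup X\<^esub> inv\<^bsub>BijGroup X\<^esub> x \<in> V}"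
    and fin: "finite ((\<lambda>v. v <#\<^bsub>BijGroup X\<^esub> W) ` V)"
    and S: "finite S" "S \<subseteq> X" "\<forall>v\<in>V. v ` S \<subseteq> S" "p \<in> S"
  shows "\<exists>S'. finite S' \<and> S' \<subseteq> X \<and> (\<forall>v\<in>V. v ` S' \<subseteq> S') \<and>
    ((inv\<^bsub>BijGroup X\<^esub> x) ^^ k) p \<in> S' \<and>
    card S' \<le> card ((\<lambda>v. v <#\<^bsub>BijGroup X\<^esub> W) ` V) ^ k * card S"
proof (induction k)
  case 0
  show ?case using S by (intro exI[of _ S]) simp
next
  case (Suc k)
  obtain S1 where S1: "finite S1" "S1 \<subseteq> X" "\<forall>v\<in>V. v ` S1 \<subseteq> S1"
      "((inv\<^bsub>BijGroup X\<^esub> x) ^^ k) p \<in> S1"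
      "card S1 \<le> card ((\<lambda>v. v <#\<^bsub>BijGroup X\<^esub> W) ` V) ^ k * card S"
    using Suc by (elim exE conjE) (rule that)
  obtain S2 where S2: "finite S2" "S2 \<subseteq> X" "\<forall>v\<in>V. v ` S2 \<subseteq> S2"
      "\<forall>c\<in>S1. (inv\<^bsub>BijGroup X\<^esub> x) c \<in> S2"
      "card S2 \<le> card ((\<lambda>v. v <#\<^bsub>BijGroup X\<^esub> W) ` V) * card S1"
    using invariant_set_growth[OF V x W fin S1(1,2,3)] by (elim exE conjE) (rule that)
  have "card S2 \<le> card ((\<lambda>v. v <#\<^bsub>BijGroup X\<^esub> W) ` V) *
      (card ((\<lambda>v. v <#\<^bsub>BijGroup X\<^esub> W) ` V) ^ k * card S)"
    using S2(5) S1(5) by (meson le_trans mult_le_mono2)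
  then have "card S2 \<le> card ((\<lambda>v. v <#\<^bsub>BijGroup X\<^esub> W) ` V) ^ Suc k * card S"
    by (simp only: power_Suc mult.assoc)
  moreover have "((inv\<^bsub>BijGroup X\<^esub> x) ^^ Suc k) p \<in> S2" using S2(4) S1(4) by simp
  ultimately show ?case using S2(1,2,3) by (intro exI[of _ S2] conjI)
qed

lemma pow_le_const_mult_powD:
  fixes a b C :: nat
  assumes "\<And>k. b ^ k \<le> C * a ^ k"
  shows "b \<le> a"
proof (rule ccontr)
  assume "\<not> b \<le> a"
  then have ab: "a < b" by simp
  show False
  proof (cases "a = 0")
    case True
    then show ?thesis using assms[of 1] ab by simp
  next
    case False
    have "1 < real b / real a" using ab False by simp
    then obtain k where "real C < (real b / real a) ^ k" using real_arch_pow by blast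
    then have "real C * real a ^ k < real b ^ k"
      using False by (simp add: power_divide pos_less_divide_eq)
    then have "C * a ^ k < b ^ k" by (metis of_nat_less_iff of_nat_mult of_nat_power)
    then show ?thesis using assms[of k] by simp
  qed
qed

text \<open>Evaluation at a point is continuous into a discrete space.\<close>

lemma compactin_finite_orbit:
  assumes G: "G \<subseteq> Bij X" and V: "compactin (subtopology (Sym_topology X) G) V" and c: "c \<in> X"
  shows "finite ((\<lambda>v. v c) ` V)"
proof -
  have "compactin (product_topology (\<lambda>_. discrete_topology X) X) V"
    using V by (simp add: Sym_topology_def compactin_subtopology)
  then have "compactin (discrete_topology X) ((\<lambda>v. v c) ` V)"
    using c by (intro image_compactin[OF _ continuous_map_product_projection]) auto
  then show ?thesis by (simp add: compactin_discrete_topology)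
qed

lemma open_subgroup_contains_fixator:
  assumes G: "subgroup G (BijGroup X)" and V: "subgroup V (BijGroup X)"
    and op: "openin (subtopology (Sym_topology X) G) V"
  shows "\<exists>F. finite F \<and> F \<subseteq> X \<and> (\<forall>g\<in>G. (\<forall>c\<in>F. g c = c) \<longrightarrow> g \<in> V)"
proof -
  interpret G: subgroup G "BijGroup X" by fact
  interpret V: subgroup V "BijGroup X" by fact
  obtain T where T: "openin (Sym_topology X) T" "V = T \<inter> G"
    using op by (auto simp: openin_subtopology)
  have "\<one>\<^bsub>BijGroup X\<^esub> \<in> T" using V.one_closed T(2) by blast
  then obtain F where F: "finite F" "F \<subseteq> X" "Sym_nbhd X \<one>\<^bsub>BijGroup X\<^esub> F \<subseteq> T"
    using T(1) by (auto simp: openin_Sym_topology)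
  have "g \<in> V" if "g \<in> G" "\<And>c. c \<in> F \<Longrightarrow> g c = c" for g
  proof -
    have "g \<in> Sym_nbhd X \<one>\<^bsub>BijGroup X\<^esub> F"
      using that G.subset F(2) by (auto simp: Sym_nbhd_def BijGroup_one_apply)
    then show ?thesis using F(3) T(2) that(1) by blast
  qed
  then show ?thesis using F(1,2) by (intro exI[of _ F] conjI ballI impI) simp_all
qed

text \<open>A subgroup is the union of its translates of a basic neighbourhood of the identity.\<close>

lemma openin_subgroup_of_fixator:
  assumes G: "subgroup G (BijGroup X)" and V: "subgroup V (BijGroup X)" and VG: "V \<subseteq> G"
    and F: "finite F" "F \<subseteq> X" "\<And>g. g \<in> G \<Longrightarrow> (\<And>c. c \<in> F \<Longrightarrow> g c = c) \<Longrightarrow> g \<in> V"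
  shows "openin (subtopology (Sym_topology X) G) V"
proof -
  interpret group "BijGroup X" by (rule group_BijGroup)
  interpret G: subgroup G "BijGroup X" by fact
  interpret V: subgroup V "BijGroup X" by fact
  have GB: "G \<subseteq> Bij X" using G.subset by simp
  define T where "T = (\<Union>v\<in>V. Sym_nbhd X v F)"
  have "openin (Sym_topology X) T"
    unfolding openin_Sym_topology
  proof (intro conjI ballI)
    show "T \<subseteq> Bij X" by (auto simp: T_def Sym_nbhd_def)
    fix x assume "x \<in> T"
    then obtain v where "v \<in> V" "x \<in> Sym_nbhd X v F" by (auto simp: T_def)
    then have "Sym_nbhd X x F \<subseteq> T" by (auto simp: T_def Sym_nbhd_def)
    then show "\<exists>F. finite F \<and> F \<subseteq> X \<and> Sym_nbhd X x F \<subseteq> T" using F by blast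
  qed
  moreover have "T \<inter> G = V"
  proof (intro equalityI subsetI)
    fix v assume "v \<in> V"
    then show "v \<in> T \<inter> G" using VG GB by (auto simp: T_def Sym_nbhd_def)
  next
    fix g assume g: "g \<in> T \<inter> G"
    then obtain v where v: "v \<in> V" "\<And>c. c \<in> F \<Longrightarrow> g c = v c"
      by (auto simp: T_def Sym_nbhd_def)
    have B: "v \<in> Bij X" "g \<in> Bij X" using v(1) VG GB g by auto
    have "(inv\<^bsub>BijGroup X\<^esub> v \<otimes>\<^bsub>BijGroup X\<^esub> g) c = c" if "c \<in> F" for c
      using that F(2) v(2)[OF that] B
      by (auto simp: BijGroup_mult_apply Bij_inv_closed BijGroup_inv_apply)
    moreover have "inv\<^bsub>BijGroup X\<^esub> v \<otimes>\<^bsub>BijGroup X\<^esub> g \<in> G" using v(1) VG g by auto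
    ultimately have "inv\<^bsub>BijGroup X\<^esub> v \<otimes>\<^bsub>BijGroup X\<^esub> g \<in> V" using F(3) by blast
    then have "v \<otimes>\<^bsub>BijGroup X\<^esub> (inv\<^bsub>BijGroup X\<^esub> v \<otimes>\<^bsub>BijGroup X\<^esub> g) \<in> V" using v(1) by blast
    then show "g \<in> V" using B by (simp add: m_assoc[symmetric] Bij_inv_closed)
  qed
  ultimately show ?thesis by (auto simp: openin_subtopology)
qed

lemma subgroup_index_conj_eq:
  assumes G: "subgroup G (BijGroup X)" and V: "subgroup V (BijGroup X)" and x: "x \<in> G"
  shows "subgroup_index (BijGroup X\<lparr>carrier := G\<rparr>) V
      (V \<inter> (inv\<^bsub>BijGroup X\<lparr>carrier := G\<rparr>\<^esub> x <#\<^bsub>BijGroup X\<lparr>carrier := G\<rparr>\<^esub> V #>\<^bsub>BijGroup X\<lparr>carrier := G\<rparr>\<^esub> x)) =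
    card ((\<lambda>v. v <#\<^bsub>BijGroup X\<^esub>
      {v \<in> V. x \<otimes>\<^bsub>BijGroup X\<^esub> v \<otimes>\<^bsub>BijGroup X\<^esub> inv\<^bsub>BijGroup X\<^esub> x \<in> V}) ` V)"
proof -
  interpret group "BijGroup X" by (rule group_BijGroup)
  have "x \<in> carrier (BijGroup X)" using subgroup.subset[OF G] x by blast
  note eq = Int_conj_eq[OF V this]
  have "inv\<^bsub>BijGroup X\<lparr>carrier := G\<rparr>\<^esub> x = inv\<^bsub>BijGroup X\<^esub> x"
    using G x by (rule m_inv_consistent)
  moreover have "(\<Union>a\<in>V. {f a}) = f ` V" for f :: "_ \<Rightarrow> ('a \<Rightarrow> 'a) set" by blast
  ultimately show ?thesis
    using eq by (simp add: subgroup_index_def LCOSETS_def l_coset_def r_coset_def)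
qed

text \<open>Any two compact open subgroups are commensurable, so orbits of \<open>U\<close> and of \<open>V\<close> differ in
  size by a bounded factor, and exponential growth of the \<open>U\<close>-orbits of the points
  \<open>x\<^sup>-\<^sup>k p\<close> forces the index of \<open>V \<inter> x\<inverse>Vx\<close> in \<open>V\<close> to be at least the growth
  rate.\<close>

lemma orbit_growth_le_index:
  assumes G: "subgroup G (BijGroup X)" and x: "x \<in> G" and p: "p \<in> X"
    and U: "compact_open_subgroup (BijGroup X\<lparr>carrier := G\<rparr>) (subtopology (Sym_topology X) G) U"
    and V: "compact_open_subgroup (BijGroup X\<lparr>carrier := G\<rparr>) (subtopology (Sym_topology X) G) V"
    and growth: "\<And>k. b ^ k \<le> card ((\<lambda>u. u (((inv\<^bsub>BijGroup X\<^esub> x) ^^ k) p)) ` U)"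
  shows "b \<le> subgroup_index (BijGroup X\<lparr>carrier := G\<rparr>) V
      (V \<inter> (inv\<^bsub>BijGroup X\<lparr>carrier := G\<rparr>\<^esub> x <#\<^bsub>BijGroup X\<lparr>carrier := G\<rparr>\<^esub> V #>\<^bsub>BijGroup X\<lparr>carrier := G\<rparr>\<^esub> x))"
proof -
  interpret group "BijGroup X" by (rule group_BijGroup)
  interpret G: subgroup G "BijGroup X" by fact
  have GB: "G \<subseteq> Bij X" using G.subset by simp
  have xB: "x \<in> Bij X" using x GB by blast
  have sub: "subgroup H (BijGroup X)" "H \<subseteq> G"
    if "compact_open_subgroup (BijGroup X\<lparr>carrier := G\<rparr>) (subtopology (Sym_topology X) G) H" for H
    using that incl_subgroup[OF G, of H] subgroup.subset[of H "BijGroup X\<lparr>carrier := G\<rparr>"]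
    by (auto simp: compact_open_subgroup_def)
  have orb: "finite ((\<lambda>v. v c) ` H)"
    if "compact_open_subgroup (BijGroup X\<lparr>carrier := G\<rparr>) (subtopology (Sym_topology X) G) H" "c \<in> X" for H c
    using that compactin_finite_orbit[OF GB] by (simp add: compact_open_subgroup_def)
  note sV = sub[OF V] and sU = sub[OF U]
  interpret V: subgroup V "BijGroup X" by (rule sV(1))
  define W where "W = {v \<in> V. x \<otimes>\<^bsub>BijGroup X\<^esub> v \<otimes>\<^bsub>BijGroup X\<^esub> inv\<^bsub>BijGroup X\<^esub> x \<in> V}"
  have sW: "subgroup W (BijGroup X)"
    unfolding W_def by (rule subgroup_Int_conj[OF sV(1)]) (use xB in simp)
  have "openin (subtopology (Sym_topology X) G) V" using V by (simp add: compact_open_subgroup_def)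
  (* V contains the pointwise stabilizer of F, so its conjugate by x contains that of the image
     of F under the inverse of x. *)
  from open_subgroup_contains_fixator[OF G sV(1) this] obtain F where F: "finite F" "F \<subseteq> X" and
      "\<forall>g\<in>G. (\<forall>c\<in>F. g c = c) \<longrightarrow> g \<in> V"
    by (elim exE conjE) (rule that)
  then have fixF: "g \<in> V" if "g \<in> G" "\<And>c. c \<in> F \<Longrightarrow> g c = c" for g
    using that by simp
  let ?i = "inv\<^bsub>BijGroup X\<^esub> x"
  have iB: "?i \<in> Bij X" using xB by (rule Bij_inv_closed)
  have finW: "finite ((\<lambda>v. v <#\<^bsub>BijGroup X\<^esub> W) ` V)"
  proof (rule finite_lcosets_of_fixator[OF sV(1) sW orb[OF V], of "?i ` F"])
    show "finite (?i ` F)" "?i ` F \<subseteq> X" using F(1,2) Bij_apply_closed[OF iB] by auto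
    fix v assume v: "v \<in> V" and fixed: "\<And>c. c \<in> ?i ` F \<Longrightarrow> v c = c"
    have vG: "v \<in> G" using v sV by blast
    have "(x \<otimes>\<^bsub>BijGroup X\<^esub> v \<otimes>\<^bsub>BijGroup X\<^esub> ?i) c = c" if c: "c \<in> F" for c
    proof -
      have cX: "c \<in> X" using c F(2) by blast
      have "(x \<otimes>\<^bsub>BijGroup X\<^esub> v \<otimes>\<^bsub>BijGroup X\<^esub> ?i) c = x (v (?i c))"
        using xB iB subsetD[OF GB vG] cX Bij_apply_closed[OF iB cX]
        by (simp add: BijGroup_mult_apply Bij_mult_closed)
      also have "\<dots> = c" using fixed[of "?i c"] c BijGroup_inv_apply(2)[OF xB cX] by simp
      finally show ?thesis .
    qed
    moreover have "x \<otimes>\<^bsub>BijGroup X\<^esub> v \<otimes>\<^bsub>BijGroup X\<^esub> ?i \<in> G" using x vG by auto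
    ultimately show "v \<in> W" using fixF v by (simp add: W_def)
  qed
  have sUV: "subgroup (U \<inter> V) (BijGroup X)"
    using sU(1) sV(1) by (rule subgroups_Inter_pair)
  have finUV: "finite ((\<lambda>u. u <#\<^bsub>BijGroup X\<^esub> (U \<inter> V)) ` U)"
    by (rule finite_lcosets_of_fixator[OF sU(1) sUV orb[OF U] F(1,2)]) (use fixF sU(2) in auto)
  obtain R where R: "R \<subseteq> U" "finite R"
      "\<And>u. u \<in> U \<Longrightarrow> \<exists>r\<in>R. \<exists>w\<in>U \<inter> V. u = r \<otimes>\<^bsub>BijGroup X\<^esub> w"
    by (rule lcoset_representatives[OF group_BijGroup sUV subgroup.subset[OF sU(1)] finUV]) (rule that)
  let ?S = "(\<lambda>v. v p) ` V"
  let ?a = "card ((\<lambda>v. v <#\<^bsub>BijGroup X\<^esub> W) ` V)"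
  have VB: "V \<subseteq> Bij X" using V.subset by simp
  have S: "finite ?S" "?S \<subseteq> X" using orb[OF V p] VB Bij_apply_closed[OF _ p] by auto
  have inv: "\<forall>v\<in>V. v ` ?S \<subseteq> ?S"
  proof (intro ballI image_subsetI)
    fix v c assume v: "v \<in> V" and c: "c \<in> ?S"
    obtain w where w: "w \<in> V" "c = w p" using c by blast
    have "v c = (v \<otimes>\<^bsub>BijGroup X\<^esub> w) p"
      using w v VB p by (subst BijGroup_mult_apply) auto
    then show "v c \<in> ?S" using V.m_closed[OF v w(1)] by blast
  qed
  have pS: "p \<in> ?S" using V.one_closed BijGroup_one_apply[OF p] by (metis imageI)
  have "b ^ k \<le> (card R * card ?S) * ?a ^ k" for k
  proof -
    let ?q = "(?i ^^ k) p"
    obtain S' where S': "finite S'" "S' \<subseteq> X" "\<forall>v\<in>V. v ` S' \<subseteq> S'"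
        "?q \<in> S'" "card S' \<le> ?a ^ k * card ?S"
      using invariant_set_growth_iterate[OF sV(1) xB W_def finW S inv pS, of k]
      by (elim exE conjE) (rule that)
    have "(\<lambda>u. u ?q) ` U \<subseteq> (\<Union>r\<in>R. r ` S')"
    proof
      fix d assume "d \<in> (\<lambda>u. u ?q) ` U"
      then obtain u where u: "u \<in> U" "d = u ?q" by blast
      then obtain r w where rw: "r \<in> R" "w \<in> U \<inter> V" "u = r \<otimes>\<^bsub>BijGroup X\<^esub> w" using R(3) by blast
      have "r \<in> Bij X" "w \<in> Bij X" using rw R(1) sU(2) GB by auto
      then have "d = r (w ?q)" using u rw S' by (auto simp: BijGroup_mult_apply)
      then show "d \<in> (\<Union>r\<in>R. r ` S')" using rw S'(4) bspec[OF S'(3), of w] by blast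
    qed
    then have "card ((\<lambda>u. u ?q) ` U) \<le> card (\<Union>r\<in>R. r ` S')"
      using R(2) S'(1) by (intro card_mono) auto
    also have "\<dots> \<le> (\<Sum>r\<in>R. card (r ` S'))" using R(2) by (rule card_UN_le)
    also have "\<dots> \<le> (\<Sum>r\<in>R. card S')" using S'(1) by (intro sum_mono card_image_le)
    also have "\<dots> \<le> card R * (?a ^ k * card ?S)" using S'(5) by simp
    finally show ?thesis using growth[of k] by (simp add: mult_ac)
  qed
  then have "b \<le> ?a" by (rule pow_le_const_mult_powD)
  then show ?thesis using subgroup_index_conj_eq[OF G sV(1) x] by (simp add: W_def)
qed

lemma tdlc_scale_eqI:
  assumes G: "subgroup G (BijGroup X)" and x: "x \<in> G" and p: "p \<in> X"
    and U: "compact_open_subgroup (BijGroup X\<lparr>carrier := G\<rparr>) (subtopology (Sym_topology X) G) U"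
    and V: "compact_open_subgroup (BijGroup X\<lparr>carrier := G\<rparr>) (subtopology (Sym_topology X) G) V"
    and growth: "\<And>k. b ^ k \<le> card ((\<lambda>u. u (((inv\<^bsub>BijGroup X\<^esub> x) ^^ k) p)) ` U)"
    and index: "card ((\<lambda>v. v <#\<^bsub>BijGroup X\<^esub>
      {v \<in> V. x \<otimes>\<^bsub>BijGroup X\<^esub> v \<otimes>\<^bsub>BijGroup X\<^esub> inv\<^bsub>BijGroup X\<^esub> x \<in> V}) ` V) \<le> b"
  shows "tdlc_scale (BijGroup X\<lparr>carrier := G\<rparr>) (subtopology (Sym_topology X) G) x = b"
proof -
  let ?ix = "\<lambda>V. subgroup_index (BijGroup X\<lparr>carrier := G\<rparr>) V
      (V \<inter> (inv\<^bsub>BijGroup X\<lparr>carrier := G\<rparr>\<^esub> x <#\<^bsub>BijGroup X\<lparr>carrier := G\<rparr>\<^esub> V #>\<^bsub>BijGroup X\<lparr>carrier := G\<rparr>\<^esub> x))"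
  have low: "b \<le> ?ix V'"
    if "compact_open_subgroup (BijGroup X\<lparr>carrier := G\<rparr>) (subtopology (Sym_topology X) G) V'" for V'
    using orbit_growth_le_index[OF G x p U that growth] .
  have "subgroup V (BijGroup X)"
    using V group.incl_subgroup[OF group_BijGroup G, of V] by (simp add: compact_open_subgroup_def)
  then have "?ix V \<le> b" using index subgroup_index_conj_eq[OF G _ x] by simp
  then have "?ix V = b" using low[OF V] by simp
  then show ?thesis
    unfolding tdlc_scale_def using V low by (intro cInf_eq_minimum) blast+
qed

section \<open>Arithmetic in Baumslag--Solitar groups\<close>

definition bs_class :: "int \<Rightarrow> int \<Rightarrow> bs_gen word \<Rightarrow> bs_gen word set" where
  "bs_class m n u = pres_rel (BS_relations m n) `` {u}"

lemma bs_class_eq_iff: "bs_class m n u = bs_class m n v \<longleftrightarrow> pres_eq (BS_relations m n) u v"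
  unfolding bs_class_def
  by (subst eq_equiv_class_iff[OF equiv_pres_rel]) (simp_all add: pres_rel_def)

lemma in_bs_class_iff: "v \<in> bs_class m n u \<longleftrightarrow> pres_eq (BS_relations m n) u v"
  by (simp add: bs_class_def pres_rel_def)

lemma bs_class_closed [simp]: "bs_class m n u \<in> carrier (BS m n)"
  by (auto simp: bs_class_def BS_def presented_group_def intro: quotientI)

lemma BS_carrier_cases:
  assumes "g \<in> carrier (BS m n)"
  obtains u where "g = bs_class m n u"
  using assms by (auto simp: bs_class_def BS_def presented_group_def elim: quotientE)

lemma bs_class_mult: "bs_class m n u \<otimes>\<^bsub>BS m n\<^esub> bs_class m n v = bs_class m n (u @ v)"
  by (simp add: bs_class_def BS_def presented_group_mult)

lemma bs_class_Nil: "bs_class m n [] = \<one>\<^bsub>BS m n\<^esub>"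
  by (simp add: bs_class_def BS_def presented_group_def)

lemma bs_class_word_inv: "bs_class m n (word_inv u) = inv\<^bsub>BS m n\<^esub> (bs_class m n u)"
proof -
  have "bs_class m n (word_inv u) \<otimes>\<^bsub>BS m n\<^esub> bs_class m n u = \<one>\<^bsub>BS m n\<^esub>"
    by (simp add: bs_class_mult bs_class_eq_iff pres_eq_word_inv flip: bs_class_Nil)
  then show ?thesis using group.inv_equality[OF group_BS] by (metis bs_class_closed)
qed

lemma BS_a_closed [simp]: "BS_a m n \<in> carrier (BS m n)"
  using bs_class_closed[of m n "gen_pow Gen_a 1"] by (simp add: BS_a_def bs_class_def)

lemma BS_a_int_pow: "BS_a m n [^]\<^bsub>BS m n\<^esub> k = bs_class m n (gen_pow Gen_a k)"
proof -
  interpret group "BS m n" by (rule group_BS)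
  have a: "BS_a m n = bs_class m n [(Gen_a, True)]"
    by (simp add: BS_a_def bs_class_def gen_pow_def)
  have nat: "BS_a m n [^]\<^bsub>BS m n\<^esub> j = bs_class m n (replicate j (Gen_a, True))" for j :: nat
  proof (induction j)
    case 0
    then show ?case by (simp add: bs_class_Nil)
  next
    case (Suc j)
    then show ?case
      by (simp add: a bs_class_mult replicate_append_same)
  qed
  show ?thesis
  proof (cases "k \<ge> 0")
    case True
    then obtain j where "k = int j" by (metis nonneg_int_cases)
    then show ?thesis using nat[of j] by (simp add: gen_pow_def int_pow_int)
  next
    case False
    then obtain j where j: "k = - int j" "j > 0" by (metis neg_int_cases linorder_not_le)
    have "gen_pow Gen_a k = word_inv (replicate j (Gen_a, True))"
      using j by (simp add: gen_pow_def word_inv_def)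
    then show ?thesis using j nat[of j] by (simp add: bs_class_word_inv int_pow_neg_int)
  qed
qed

text \<open>The group acts on the line by \<open>a(x) = x + 1\<close> and \<open>t(x) = q x\<close> with \<open>q = n / m\<close>.  The word \<open>w\<close>
  then acts by \<open>x \<mapsto> q\<^sup>e x + s\<close>, where \<open>e\<close> is its exponent sum in \<open>t\<close> and \<open>s\<close> is
  \<open>bs_shift q w\<close>.\<close>

fun bs_expo :: "bs_gen word \<Rightarrow> int" where
  "bs_expo [] = 0"
| "bs_expo ((Gen_a, b) # w) = bs_expo w"
| "bs_expo ((Gen_t, b) # w) = (if b then 1 else - 1) + bs_expo w"

fun bs_shift :: "real \<Rightarrow> bs_gen word \<Rightarrow> real" where
  "bs_shift q [] = 0"
| "bs_shift q ((Gen_a, b) # w) = (if b then 1 else - 1) + bs_shift q w"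
| "bs_shift q ((Gen_t, b) # w) = (if b then q else inverse q) * bs_shift q w"

lemma bs_expo_append: "bs_expo (u @ v) = bs_expo u + bs_expo v"
  by (induction u rule: bs_expo.induct) auto

lemma bs_shift_append:
  assumes "q \<noteq> 0"
  shows "bs_shift q (u @ v) = bs_shift q u + q powi bs_expo u * bs_shift q v"
  using assms
  by (induction u rule: bs_expo.induct)
     (auto simp: power_int_add power_int_diff power_int_minus field_simps)

lemma bs_expo_replicate_a: "bs_expo (replicate j (Gen_a, b)) = 0"
  by (induction j) auto

lemma bs_shift_replicate_a: "bs_shift q (replicate j (Gen_a, b)) = (if b then real j else - real j)"
  by (induction j) auto

lemma bs_expo_gen_pow_a: "bs_expo (gen_pow Gen_a k) = 0"
  by (simp add: gen_pow_def bs_expo_replicate_a)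

lemma bs_shift_gen_pow_a: "bs_shift q (gen_pow Gen_a k) = real_of_int k"
  by (simp add: gen_pow_def bs_shift_replicate_a)

lemma bs_affine_invariant:
  assumes mn: "m \<noteq> 0" "n \<noteq> 0" and q: "q = real_of_int n / real_of_int m"
    and "pres_eq (BS_relations m n) u v"
  shows "bs_expo u = bs_expo v \<and> bs_shift q u = bs_shift q v"
proof -
  have q0: "q \<noteq> 0" using mn q by simp
  show ?thesis
    using assms(4)
  proof (induction rule: pres_eq.induct)
    case (cancel u g b v)
    have "bs_expo [(g, b), (g, \<not> b)] = 0" "bs_shift q [(g, b), (g, \<not> b)] = 0"
      by (cases g; simp)+
    then show ?case by (simp add: bs_expo_append bs_shift_append[OF q0] del: bs_expo.simps bs_shift.simps append_Cons)
  next
    case (relation l r u v)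
    then have l: "l = (Gen_t, True) # gen_pow Gen_a m @ [(Gen_t, False)]" and r: "r = gen_pow Gen_a n"
      by (auto simp: BS_relations_def gen_pow_def)
    have "bs_expo l = bs_expo r" "bs_shift q l = bs_shift q r"
      using mn q q0 unfolding l r
      by (simp_all add: bs_expo_append bs_shift_append bs_expo_gen_pow_a bs_shift_gen_pow_a)
    then show ?case by (simp add: bs_expo_append bs_shift_append[OF q0])
  qed auto
qed

lemma bs_expo_cong:
  assumes "m \<noteq> 0" "n \<noteq> 0" "bs_class m n u = bs_class m n v"
  shows "bs_expo u = bs_expo v"
  using bs_affine_invariant[OF assms(1,2) HOL.refl] assms(3) by (simp add: bs_class_eq_iff)

text \<open>Up to sign, the scale of an element with exponent sum \<open>\<rho>\<close>.  With \<open>m = d m'\<close> and \<open>n = d n'\<close> in lowest terms, the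
  fraction \<open>(n / m)\<^sup>\<rho>\<close> equals \<open>B (- \<rho>) / B \<rho>\<close> in lowest terms for every integer \<open>\<rho>\<close>, where \<open>B\<close>
  is the following function.\<close>

definition bs_factor :: "int \<Rightarrow> int \<Rightarrow> int \<Rightarrow> int" where
  "bs_factor m n \<rho> = (if \<rho> \<ge> 0 then (m div gcd m n) ^ nat \<rho> else (n div gcd m n) ^ nat (- \<rho>))"

lemma bs_factor_nonzero: "m \<noteq> 0 \<Longrightarrow> n \<noteq> 0 \<Longrightarrow> bs_factor m n \<rho> \<noteq> 0"
  by (simp add: bs_factor_def dvd_div_eq_0_iff)

lemma coprime_bs_factor:
  assumes "m \<noteq> 0" "n \<noteq> 0"
  shows "coprime (bs_factor m n \<rho>) (bs_factor m n (- \<rho>))"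
proof -
  have c: "coprime (m div gcd m n) (n div gcd m n)"
    using assms by (simp add: div_gcd_coprime)
  show ?thesis
    using c by (auto simp: bs_factor_def coprime_commute)
qed

lemma bs_factor_mult_nat: "bs_factor m n (int k * \<rho>) = bs_factor m n \<rho> ^ k"
proof (cases "k = 0")
  case False
  then have "0 \<le> int k * \<rho> \<longleftrightarrow> 0 \<le> \<rho>" by (simp add: zero_le_mult_iff)
  moreover have "nat (int k * \<rho>) = nat \<rho> * k" "nat (- (int k * \<rho>)) = nat (- \<rho>) * k"
    using nat_mult_distrib[of "int k" \<rho>] nat_mult_distrib[of "int k" "- \<rho>"] by simp_all
  ultimately show ?thesis by (simp add: bs_factor_def power_mult)
qed (simp add: bs_factor_def)

lemma bs_factor_ratio:
  assumes mn: "m \<noteq> 0" "n \<noteq> 0"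
  shows "(real_of_int n / real_of_int m) powi \<rho> * real_of_int (bs_factor m n \<rho>) =
    real_of_int (bs_factor m n (- \<rho>))"
proof -
  let ?d = "gcd m n"
  let ?m = "real_of_int (m div ?d)" and ?n = "real_of_int (n div ?d)"
  have "real_of_int m = real_of_int ?d * ?m" "real_of_int n = real_of_int ?d * ?n"
    by (simp_all flip: of_int_mult)
  moreover have "real_of_int ?d \<noteq> 0" using mn by simp
  ultimately have q: "real_of_int n / real_of_int m = ?n / ?m" by (metis mult_divide_mult_cancel_left)
  have nz: "?m \<noteq> 0" "?n \<noteq> 0" using mn by (simp_all add: dvd_div_eq_0_iff)
  consider "\<rho> > 0" | "\<rho> = 0" | "\<rho> < 0" by linarith
  then show ?thesis
  proof cases
    case 1
    then show ?thesis using nz unfolding q by (simp add: bs_factor_def power_int_def power_divide)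
  next
    case 2
    then show ?thesis by (simp add: bs_factor_def)
  next
    case 3
    then show ?thesis using nz unfolding q
      by (simp add: bs_factor_def power_int_def power_divide)
  qed
qed

text \<open>Comparing the translation parts of both sides of \<open>a\<^sup>i u = u a\<^sup>j\<close> in the affine action gives
  \<open>i = (n / m)\<^sup>e j\<close>, with \<open>e\<close> the exponent sum of \<open>u\<close>.\<close>

lemma bs_commutation_ratio:
  assumes mn: "m \<noteq> 0" "n \<noteq> 0"
    and eq: "bs_class m n (gen_pow Gen_a i @ u) = bs_class m n (u @ gen_pow Gen_a j)"
  shows "i * bs_factor m n (bs_expo u) = j * bs_factor m n (- bs_expo u)"
proof -
  define q where "q = real_of_int n / real_of_int m"
  have q0: "q \<noteq> 0" using mn by (simp add: q_def)
  have "bs_shift q (gen_pow Gen_a i @ u) = bs_shift q (u @ gen_pow Gen_a j)"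
    using bs_affine_invariant[OF mn q_def] eq by (simp add: bs_class_eq_iff)
  then have "real_of_int i = q powi bs_expo u * real_of_int j"
    by (simp add: bs_shift_append[OF q0] bs_expo_gen_pow_a bs_shift_gen_pow_a)
  then have "real_of_int (i * bs_factor m n (bs_expo u)) =
      real_of_int j * (q powi bs_expo u * real_of_int (bs_factor m n (bs_expo u)))"
    by simp
  also have "\<dots> = real_of_int (j * bs_factor m n (- bs_expo u))"
    using bs_factor_ratio[OF mn, of "bs_expo u"] by (simp add: q_def)
  finally show ?thesis by (simp only: of_int_eq_iff)
qed

lemma (in group) int_pow_intertwine:
  fixes k :: int
  assumes "x \<in> carrier G" "b \<in> carrier G" "c \<in> carrier G" "x \<otimes> b = c \<otimes> x"
  shows "x \<otimes> b [^] k = c [^] k \<otimes> x"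
proof -
  have nat: "x \<otimes> b [^] j = c [^] j \<otimes> x" for j :: nat
  proof (induction j)
    case (Suc j)
    have "x \<otimes> b [^] Suc j = (x \<otimes> b [^] j) \<otimes> b" using assms by (simp add: m_assoc)
    also have "\<dots> = c [^] j \<otimes> (x \<otimes> b)" using Suc assms by (simp add: m_assoc)
    also have "\<dots> = c [^] Suc j \<otimes> x" using assms by (simp add: m_assoc)
    finally show ?case .
  qed (use assms in simp)
  show ?thesis
  proof (cases k)
    case (nonneg j)
    then show ?thesis using nat[of j] by (simp add: int_pow_int)
  next
    case (neg j)
    define p r where "p = b [^] Suc j" and "r = c [^] Suc j"
    have pr: "p \<in> carrier G" "r \<in> carrier G" "x \<otimes> p = r \<otimes> x"
      using nat[of "Suc j"] assms unfolding p_def r_def by (auto simp del: nat_pow_Suc)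
    have "inv r \<otimes> x = inv r \<otimes> (x \<otimes> p) \<otimes> inv p" using pr(1,2) assms(1) by (simp add: m_assoc)
    also have "\<dots> = x \<otimes> inv p" using pr assms(1) by (simp add: inv_cancel_left)
    finally have "inv (c [^] Suc j) \<otimes> x = x \<otimes> inv (b [^] Suc j)" by (simp only: p_def r_def)
    then show ?thesis using neg assms by (simp add: int_pow_neg_int del: nat_pow_Suc of_nat_Suc)
  qed
qed

lemma BS_t_conj:
  fixes m n k :: int
  defines "A \<equiv> \<lambda>i::int. BS_a m n [^]\<^bsub>BS m n\<^esub> i"
  defines "t \<equiv> bs_class m n [(Gen_t, True)]" and "t' \<equiv> bs_class m n [(Gen_t, False)]"
  shows "A (n * k) \<otimes>\<^bsub>BS m n\<^esub> t = t \<otimes>\<^bsub>BS m n\<^esub> A (m * k)"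
    and "A (m * k) \<otimes>\<^bsub>BS m n\<^esub> t' = t' \<otimes>\<^bsub>BS m n\<^esub> A (n * k)"
proof -
  interpret group "BS m n" by (rule group_BS)
  have c: "t \<in> carrier (BS m n)" "A i \<in> carrier (BS m n)" for i by (simp_all add: t_def A_def)
  have t': "t' = inv\<^bsub>BS m n\<^esub> t"
    using bs_class_word_inv[of m n "[(Gen_t, True)]"] by (simp add: t_def t'_def word_inv_def)
  have "bs_class m n (gen_pow Gen_t 1 @ gen_pow Gen_a m @ gen_pow Gen_t (- 1)) =
      bs_class m n (gen_pow Gen_a n)"
    unfolding bs_class_eq_iff
    using pres_eq.relation[of "gen_pow Gen_t 1 @ gen_pow Gen_a m @ gen_pow Gen_t (- 1)"
        "gen_pow Gen_a n" "BS_relations m n" "[]" "[]"]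
    by (simp add: BS_relations_def)
  then have "t \<otimes>\<^bsub>BS m n\<^esub> A m \<otimes>\<^bsub>BS m n\<^esub> t' = A n"
    by (simp add: t_def t'_def A_def BS_a_int_pow bs_class_mult gen_pow_def)
  then have rel: "t \<otimes>\<^bsub>BS m n\<^esub> A m = A n \<otimes>\<^bsub>BS m n\<^esub> t"
    using c unfolding t' by (metis inv_closed inv_solve_right' m_closed inv_inv)
  have "t \<otimes>\<^bsub>BS m n\<^esub> (A m [^]\<^bsub>BS m n\<^esub> k) = (A n [^]\<^bsub>BS m n\<^esub> k) \<otimes>\<^bsub>BS m n\<^esub> t"
    using c rel by (intro int_pow_intertwine) auto
  then show *: "A (n * k) \<otimes>\<^bsub>BS m n\<^esub> t = t \<otimes>\<^bsub>BS m n\<^esub> A (m * k)"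
    by (simp add: A_def int_pow_pow)
  have "t' \<otimes>\<^bsub>BS m n\<^esub> (A (n * k) \<otimes>\<^bsub>BS m n\<^esub> t) \<otimes>\<^bsub>BS m n\<^esub> t' =
      t' \<otimes>\<^bsub>BS m n\<^esub> (t \<otimes>\<^bsub>BS m n\<^esub> A (m * k)) \<otimes>\<^bsub>BS m n\<^esub> t'"
    using * by simp
  then show "A (m * k) \<otimes>\<^bsub>BS m n\<^esub> t' = t' \<otimes>\<^bsub>BS m n\<^esub> A (n * k)"
    using c unfolding t' by (simp add: m_assoc inv_cancel_left)
qed

text \<open>Moving a power of \<open>a\<close> through a letter \<open>t\<close> or \<open>t\<inverse>\<close> is possible when the exponent is a multiple
  of \<open>n\<close> or \<open>m\<close>.  Raising the relation for the shorter word to a suitable power makes it so, which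
  carries the induction over the letters.\<close>

lemma BS_commensurated:
  assumes mn: "m \<noteq> 0" "n \<noteq> 0"
  shows "\<exists>N N'. N \<noteq> 0 \<and> BS_a m n [^]\<^bsub>BS m n\<^esub> (N::int) \<otimes>\<^bsub>BS m n\<^esub> bs_class m n u =
    bs_class m n u \<otimes>\<^bsub>BS m n\<^esub> BS_a m n [^]\<^bsub>BS m n\<^esub> (N'::int)"
proof (induction u)
  interpret group "BS m n" by (rule group_BS)
  case Nil
  show ?case by (intro exI[of _ 1]) (simp add: bs_class_Nil)
next
  interpret group "BS m n" by (rule group_BS)
  let ?A = "\<lambda>i::int. BS_a m n [^]\<^bsub>BS m n\<^esub> i"
  case (Cons x u)
  let ?x = "bs_class m n [x]" and ?u = "bs_class m n u"
  obtain N N' where N: "N \<noteq> 0" "?A N \<otimes>\<^bsub>BS m n\<^esub> ?u = ?u \<otimes>\<^bsub>BS m n\<^esub> ?A N'"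
    using Cons by (elim exE conjE)
  have "\<exists>i j. i \<noteq> 0 \<and> j \<noteq> 0 \<and> (\<forall>k. ?A (i * k) \<otimes>\<^bsub>BS m n\<^esub> ?x = ?x \<otimes>\<^bsub>BS m n\<^esub> ?A (j * k))"
  proof -
    obtain g b where x: "x = (g, b)" by fastforce
    show ?thesis
    proof (cases g)
      case Gen_a
      have "?x = ?A (if b then 1 else - 1)"
        unfolding BS_a_int_pow by (simp add: gen_pow_def x Gen_a)
      moreover have "?A k \<otimes>\<^bsub>BS m n\<^esub> ?A i = ?A i \<otimes>\<^bsub>BS m n\<^esub> ?A k" for k i
        using int_pow_mult[OF BS_a_closed, of k i] int_pow_mult[OF BS_a_closed, of i k]
        by (simp only: add.commute)
      ultimately have "?A (1 * k) \<otimes>\<^bsub>BS m n\<^esub> ?x = ?x \<otimes>\<^bsub>BS m n\<^esub> ?A (1 * k)" for k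
        by (simp only: mult_1)
      then show ?thesis by (intro exI[of _ 1] conjI allI) simp_all
    next
      case Gen_t
      show ?thesis
      proof (cases b)
        case True
        then show ?thesis using BS_t_conj(1)[of m n] mn x Gen_t
          by (intro exI[of _ n] exI[of _ m]) simp
      next
        case False
        then show ?thesis using BS_t_conj(2)[of m n] mn x Gen_t
          by (intro exI[of _ m] exI[of _ n]) simp
      qed
    qed
  qed
  then obtain i j where ij: "i \<noteq> 0" "j \<noteq> 0"
    "\<And>k. ?A (i * k) \<otimes>\<^bsub>BS m n\<^esub> ?x = ?x \<otimes>\<^bsub>BS m n\<^esub> ?A (j * k)" by (elim exE conjE) simp
  have "?u \<otimes>\<^bsub>BS m n\<^esub> (?A N' [^]\<^bsub>BS m n\<^esub> j) = (?A N [^]\<^bsub>BS m n\<^esub> j) \<otimes>\<^bsub>BS m n\<^esub> ?u"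
    using N(2) by (intro int_pow_intertwine) auto
  then have u: "?A (j * N) \<otimes>\<^bsub>BS m n\<^esub> ?u = ?u \<otimes>\<^bsub>BS m n\<^esub> ?A (j * N')"
    by (simp add: int_pow_pow mult.commute)
  have xu: "bs_class m n (x # u) = ?x \<otimes>\<^bsub>BS m n\<^esub> ?u" by (simp add: bs_class_mult)
  have "?A (i * N) \<otimes>\<^bsub>BS m n\<^esub> (?x \<otimes>\<^bsub>BS m n\<^esub> ?u) = (?x \<otimes>\<^bsub>BS m n\<^esub> ?A (j * N)) \<otimes>\<^bsub>BS m n\<^esub> ?u"
    using ij(3)[of N] by (simp add: m_assoc[symmetric])
  also have "\<dots> = (?x \<otimes>\<^bsub>BS m n\<^esub> ?u) \<otimes>\<^bsub>BS m n\<^esub> ?A (j * N')"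
    using u by (simp add: m_assoc)
  finally show ?case using ij(1) N(1) xu by (intro exI[of _ "i * N"] exI[of _ "j * N'"]) simp
qed

section \<open>The action on the cosets of \<open>\<langle>a\<rangle>\<close>\<close>

lemma perm_closure_commute:
  assumes P: "P \<subseteq> Bij X"
    and comm: "\<And>g h. g \<in> P \<Longrightarrow> h \<in> P \<Longrightarrow> g \<otimes>\<^bsub>BijGroup X\<^esub> h = h \<otimes>\<^bsub>BijGroup X\<^esub> g"
    and yz: "y \<in> perm_closure X P" "z \<in> perm_closure X P"
  shows "y \<otimes>\<^bsub>BijGroup X\<^esub> z = z \<otimes>\<^bsub>BijGroup X\<^esub> y"
proof -
  have B: "y \<in> Bij X" "z \<in> Bij X" using yz by (auto dest: perm_closure_Bij)
  have "(y \<otimes>\<^bsub>BijGroup X\<^esub> z) c = (z \<otimes>\<^bsub>BijGroup X\<^esub> y) c" if c: "c \<in> X" for c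
  proof -
    have yc: "y c \<in> X" and zc: "z c \<in> X" using Bij_apply_closed B c by metis+
    obtain g where g: "g \<in> P" "\<And>d. d \<in> {c, z c} \<Longrightarrow> g d = y d"
      using perm_closureD[OF yz(1), of "{c, z c}"] c zc by auto
    obtain h where h: "h \<in> P" "\<And>d. d \<in> {c, y c} \<Longrightarrow> h d = z d"
      using perm_closureD[OF yz(2), of "{c, y c}"] c yc by auto
    have gB: "g \<in> Bij X" and hB: "h \<in> Bij X" using g(1) h(1) P by auto
    have "(g \<otimes>\<^bsub>BijGroup X\<^esub> h) c = (h \<otimes>\<^bsub>BijGroup X\<^esub> g) c" using comm[OF g(1) h(1)] by simp
    then show ?thesis using g(2) h(2) by (simp add: BijGroup_mult_apply B gB hB c)
  qed
  then show ?thesis using Bij_mult_closed B by (intro Bij_eqI[of _ X]) auto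
qed

locale BS_nonzero =
  fixes m n :: int
  assumes m0: "m \<noteq> 0" and n0: "n \<noteq> 0"
begin

sublocale BS: group "BS m n" by (rule group_BS)

abbreviation "X \<equiv> BS_cosets m n"

sublocale Sym: group "BijGroup X" by (rule group_BijGroup)

definition coset :: "bs_gen word \<Rightarrow> bs_gen word set set" where
  "coset u = bs_class m n u <#\<^bsub>BS m n\<^esub> generate (BS m n) {BS_a m n}"

definition act :: "bs_gen word \<Rightarrow> bs_gen word set set \<Rightarrow> bs_gen word set set" where
  "act u = BS_action m n (bs_class m n u)"

text \<open>The permutations given by the powers of \<open>a\<close>, which rotate the neighbours of the base coset in
  the Bass--Serre tree.\<close>

definition rot :: "int \<Rightarrow> bs_gen word set set \<Rightarrow> bs_gen word set set" where
  "rot k = act (gen_pow Gen_a k)"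

definition rots :: "int \<Rightarrow> (bs_gen word set set \<Rightarrow> bs_gen word set set) set" where
  "rots N = range (\<lambda>k. rot (N * k))"

lemma generate_a: "generate (BS m n) {BS_a m n} = range (\<lambda>k. bs_class m n (gen_pow Gen_a k))"
  using BS.generate_pow[OF BS_a_closed] by (auto simp: BS_a_int_pow)

lemma subgroup_generate_a: "subgroup (generate (BS m n) {BS_a m n}) (BS m n)"
  by (rule BS.generate_is_subgroup) simp

lemma generate_a_subset: "generate (BS m n) {BS_a m n} \<subseteq> carrier (BS m n)"
  using subgroup_generate_a by (rule subgroup.subset)

lemma coset_eq_range: "coset u = range (\<lambda>k. bs_class m n (u @ gen_pow Gen_a k))"
  by (auto simp: coset_def l_coset_def generate_a bs_class_mult)

lemma coset_closed [simp]: "coset u \<in> X"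
  by (auto simp: coset_def BS_cosets_def LCOSETS_def)

lemma coset_cases:
  assumes "C \<in> X" obtains u where "C = coset u"
  using assms by (auto simp: coset_def BS_cosets_def LCOSETS_def elim!: BS_carrier_cases)

lemma class_in_coset: "bs_class m n u \<in> coset u"
  unfolding coset_eq_range by (rule range_eqI[of _ _ 0]) (simp add: gen_pow_def)

lemma coset_eqD:
  assumes "coset u = coset v"
  obtains k where "bs_class m n v = bs_class m n (u @ gen_pow Gen_a k)"
proof -
  have "bs_class m n v \<in> coset u" using class_in_coset[of v] by (simp only: assms)
  then show thesis unfolding coset_eq_range using that by (elim rangeE)
qed

lemma coset_eqI:
  assumes "bs_class m n v = bs_class m n (u @ gen_pow Gen_a k)"
  shows "coset v = coset u"
proof -
  have "bs_class m n v \<in> coset u" unfolding coset_eq_range using assms by (rule range_eqI)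
  then show ?thesis unfolding coset_def
    by (intro BS.l_repr_independence[symmetric] subgroup_generate_a) simp_all
qed

lemma gen_pow_add_class:
  "bs_class m n (gen_pow Gen_a i @ gen_pow Gen_a j) = bs_class m n (gen_pow Gen_a (i + j))"
  using BS.int_pow_mult[OF BS_a_closed, of i j] by (simp only: BS_a_int_pow bs_class_mult)

lemma act_coset: "act u (coset v) = coset (u @ v)"
proof -
  have "act u (coset v) = bs_class m n u <#\<^bsub>BS m n\<^esub> coset v"
    by (simp add: act_def BS_action_def)
  also have "\<dots> = coset (u @ v)"
    using BS.lcos_m_assoc[OF generate_a_subset bs_class_closed bs_class_closed, of u v]
    unfolding coset_def by (simp only: bs_class_mult)
  finally show ?thesis .
qed

lemma act_cong: "bs_class m n u = bs_class m n v \<Longrightarrow> act u = act v"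
  by (simp add: act_def)

lemma coset_word_inv: "coset (word_inv u @ u @ v) = coset v" "coset (u @ word_inv u @ v) = coset v"
proof -
  have "bs_class m n (word_inv u @ u @ v) = bs_class m n v"
    "bs_class m n (u @ word_inv u @ v) = bs_class m n v"
    by (simp_all add: bs_class_word_inv BS.inv_cancel_left flip: bs_class_mult)
  then show "coset (word_inv u @ u @ v) = coset v" "coset (u @ word_inv u @ v) = coset v"
    by (simp_all add: coset_def)
qed

lemma act_Bij: "act u \<in> Bij X"
proof -
  have "bij_betw (act u) X X"
    by (rule bij_betw_byWitness[where f' = "act (word_inv u)"])
      (auto elim!: coset_cases simp: act_coset coset_word_inv)
  then show ?thesis by (simp add: Bij_def act_def BS_action_def)
qed

lemma act_mult: "act u \<otimes>\<^bsub>BijGroup X\<^esub> act v = act (u @ v)"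
proof (rule Bij_eqI[of _ X])
  fix C assume "C \<in> X"
  then obtain w where "C = coset w" by (rule coset_cases)
  then show "(act u \<otimes>\<^bsub>BijGroup X\<^esub> act v) C = act (u @ v) C"
    by (simp add: BijGroup_mult_apply act_Bij act_coset)
qed (simp_all add: act_Bij Bij_mult_closed)

lemma act_Nil: "act [] = \<one>\<^bsub>BijGroup X\<^esub>"
proof (rule Bij_eqI[of _ X])
  fix C assume "C \<in> X"
  then show "act [] C = \<one>\<^bsub>BijGroup X\<^esub> C"
    by (elim coset_cases) (simp add: act_coset BijGroup_one_apply)
qed (use act_Bij Sym.one_closed in simp_all)

lemma act_inv: "inv\<^bsub>BijGroup X\<^esub> (act u) = act (word_inv u)"
proof (rule Sym.inv_equality)
  have "bs_class m n (word_inv u @ u) = bs_class m n []"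
    by (simp add: bs_class_eq_iff pres_eq_word_inv)
  then show "act (word_inv u) \<otimes>\<^bsub>BijGroup X\<^esub> act u = \<one>\<^bsub>BijGroup X\<^esub>"
    unfolding act_mult by (metis act_cong act_Nil)
qed (simp_all add: act_Bij)

lemma subgroup_act: "subgroup (range act) (BijGroup X)"
proof (rule Sym.subgroupI)
  show "inv\<^bsub>BijGroup X\<^esub> g \<in> range act" if "g \<in> range act" for g
    using that by (auto simp: act_inv)
  show "g \<otimes>\<^bsub>BijGroup X\<^esub> h \<in> range act" if "g \<in> range act" "h \<in> range act" for g h
    using that by (auto simp: act_mult)
qed (use act_Bij in auto)

lemma BS_action_image: "BS_action m n ` carrier (BS m n) = range act"
  by (auto simp: act_def elim!: BS_carrier_cases)

lemma rot_Bij: "rot k \<in> Bij X"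
  by (simp add: rot_def act_Bij)

lemma rot_mult: "rot i \<otimes>\<^bsub>BijGroup X\<^esub> rot j = rot (i + j)"
  unfolding rot_def act_mult by (rule act_cong[OF gen_pow_add_class])

lemma rot_0: "rot 0 = \<one>\<^bsub>BijGroup X\<^esub>"
  by (simp add: rot_def gen_pow_def act_Nil)

lemma rot_inv: "inv\<^bsub>BijGroup X\<^esub> (rot k) = rot (- k)"
  by (rule Sym.inv_equality) (simp_all add: rot_mult rot_0 rot_Bij)

lemma rot_coset: "rot k (coset u) = coset (gen_pow Gen_a k @ u)"
  by (simp add: rot_def act_coset)

lemma rots_Bij: "rots N \<subseteq> Bij X"
  by (auto simp: rots_def rot_Bij)

lemma subgroup_rots: "subgroup (rots N) (BijGroup X)"
proof (rule Sym.subgroupI)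
  show "inv\<^bsub>BijGroup X\<^esub> g \<in> rots N" if "g \<in> rots N" for g
  proof -
    obtain k where "g = rot (N * k)" using \<open>g \<in> rots N\<close> by (auto simp: rots_def)
    then have "inv\<^bsub>BijGroup X\<^esub> g = rot (N * (- k))" by (simp add: rot_inv)
    then show ?thesis unfolding rots_def by (rule range_eqI)
  qed
  show "g \<otimes>\<^bsub>BijGroup X\<^esub> h \<in> rots N" if gh: "g \<in> rots N" "h \<in> rots N" for g h
  proof -
    obtain i j where "g = rot (N * i)" "h = rot (N * j)" using gh by (auto simp: rots_def)
    then have "g \<otimes>\<^bsub>BijGroup X\<^esub> h = rot (N * (i + j))" by (simp add: rot_mult distrib_left)
    then show ?thesis unfolding rots_def by (rule range_eqI)
  qed
qed (use rots_Bij in \<open>auto simp: rots_def\<close>)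

lemma rots_mult_subset: "rots (N * k) \<subseteq> rots N"
  by (auto simp: rots_def mult.assoc)

lemma rots_subset_act: "rots N \<subseteq> range act"
  by (auto simp: rots_def rot_def)

text \<open>Here \<open>N K\<close> may be negative, whereas the representatives are counted by \<open>\<bar>K\<bar>\<close>; the sign is absorbed
  into the exponent of \<open>a\<^bsup>NK\<^esup>\<close>.\<close>

lemma rots_cosets:
  assumes "K \<noteq> 0"
  shows "rots N \<subseteq> (\<Union>g\<in>(\<lambda>i. rot (N * i)) ` {0..<\<bar>K\<bar>}. (\<lambda>q. g \<otimes>\<^bsub>BijGroup X\<^esub> q) ` rots (N * K))"
proof
  fix g assume "g \<in> rots N"
  then obtain k where k: "g = rot (N * k)" unfolding rots_def by (elim rangeE)
  have "k = k mod \<bar>K\<bar> + \<bar>K\<bar> * (k div \<bar>K\<bar>)" by simp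
  then have "N * k = N * (k mod \<bar>K\<bar>) + N * K * (sgn K * (k div \<bar>K\<bar>))"
    by (metis abs_sgn distrib_left mult.assoc)
  then have "g = rot (N * (k mod \<bar>K\<bar>)) \<otimes>\<^bsub>BijGroup X\<^esub> rot (N * K * (sgn K * (k div \<bar>K\<bar>)))"
    by (simp only: k rot_mult)
  moreover have "k mod \<bar>K\<bar> \<in> {0..<\<bar>K\<bar>}" using assms by simp
  moreover have "rot (N * K * (sgn K * (k div \<bar>K\<bar>))) \<in> rots (N * K)"
    unfolding rots_def by (rule rangeI)
  ultimately show "g \<in> (\<Union>g\<in>(\<lambda>i. rot (N * i)) ` {0..<\<bar>K\<bar>}. (\<lambda>q. g \<otimes>\<^bsub>BijGroup X\<^esub> q) ` rots (N * K))"
    by (intro UN_I[OF imageI] image_eqI)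
qed

lemma commensurated_words:
  obtains N N' where "N \<noteq> 0"
    "\<And>k. bs_class m n (gen_pow Gen_a (N * k) @ u) = bs_class m n (u @ gen_pow Gen_a (N' * k))"
proof -
  obtain N N' :: int where N: "N \<noteq> 0" "BS_a m n [^]\<^bsub>BS m n\<^esub> N \<otimes>\<^bsub>BS m n\<^esub> bs_class m n u =
    bs_class m n u \<otimes>\<^bsub>BS m n\<^esub> BS_a m n [^]\<^bsub>BS m n\<^esub> N'"
    using BS_commensurated[OF m0 n0, of u] by (elim exE conjE)
  have "bs_class m n (gen_pow Gen_a (N * k) @ u) = bs_class m n (u @ gen_pow Gen_a (N' * k))" for k
    using BS.int_pow_intertwine[OF bs_class_closed _ _ N(2)[symmetric], of k]
    by (simp add: BS.int_pow_pow) (simp only: BS_a_int_pow bs_class_mult)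
  then show thesis using that N(1) by simp
qed

text \<open>Some power \<open>a\<^sup>K\<close> with \<open>K \<noteq> 0\<close> satisfies \<open>a\<^sup>K u \<in> u \<langle>a\<rangle>\<close> and hence fixes the coset of \<open>u\<close>,
  so the orbit depends only on exponents modulo \<open>K\<close>.\<close>

lemma finite_rots_orbit:
  assumes "C \<in> X"
  shows "finite ((\<lambda>g. g C) ` rots N)"
proof -
  obtain u where C: "C = coset u" using assms by (rule coset_cases)
  obtain K K' where K: "K \<noteq> 0"
    "\<And>k. bs_class m n (gen_pow Gen_a (K * k) @ u) = bs_class m n (u @ gen_pow Gen_a (K' * k))"
    using commensurated_words[of u] by metis
  have fixC: "rot (K * k) C = C" for k
    unfolding C rot_coset by (rule coset_eqI[OF K(2)])
  have "rot k C = rot (k mod K) C" for k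
  proof -
    have "rot k = rot (k mod K) \<otimes>\<^bsub>BijGroup X\<^esub> rot (K * (k div K))" by (simp add: rot_mult)
    then show ?thesis using fixC[of "k div K"] assms by (simp add: BijGroup_mult_apply rot_Bij)
  qed
  moreover have "k mod K \<in> {- \<bar>K\<bar>..\<bar>K\<bar>}" for k
    using abs_mod_less[OF K(1), of k] by auto
  ultimately have "(\<lambda>g. g C) ` rots N \<subseteq> (\<lambda>k. rot k C) ` {- \<bar>K\<bar>..\<bar>K\<bar>}"
    unfolding rots_def image_image by (metis (no_types, lifting) image_eqI image_subsetI)
  then show ?thesis by (rule finite_subset) simp
qed

end

section \<open>The scale function of \<open>G\<^bsub>m,n\<^esub>\<close>\<close>

context BS_nonzero begin

definition BS_closure :: "(bs_gen word set set \<Rightarrow> bs_gen word set set) set" where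
  "BS_closure = perm_closure X (range act)"

definition rot_closure :: "int \<Rightarrow> (bs_gen word set set \<Rightarrow> bs_gen word set set) set" where
  "rot_closure N = perm_closure X (rots N)"

lemma range_act_Bij: "range act \<subseteq> Bij X"
  using act_Bij by auto

lemma GBS_carrier_eq: "GBS_carrier m n = BS_closure"
  unfolding GBS_carrier_def BS_closure_def BS_action_image
  by (rule Sym_closure_eq_perm_closure[OF range_act_Bij])

lemma GBS_eq: "GBS m n = BijGroup X\<lparr>carrier := BS_closure\<rparr>"
  by (simp add: GBS_def GBS_carrier_eq)

lemma GBS_topology_eq: "GBS_topology m n = subtopology (Sym_topology X) BS_closure"
  by (simp add: GBS_topology_def GBS_carrier_eq)

lemma subgroup_BS_closure: "subgroup BS_closure (BijGroup X)"
  unfolding BS_closure_def by (rule subgroup_perm_closure[OF subgroup_act])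

lemma BS_closure_Bij: "BS_closure \<subseteq> Bij X"
  using subgroup.subset[OF subgroup_BS_closure] by simp

lemma act_BS_closure: "act u \<in> BS_closure"
  using perm_closure_superset[OF range_act_Bij] by (auto simp: BS_closure_def)

lemma BS_closure_inv: "x \<in> BS_closure \<Longrightarrow> inv\<^bsub>BijGroup X\<^esub> x \<in> BS_closure"
  by (rule subgroup.m_inv_closed[OF subgroup_BS_closure])

lemma subgroup_rot_closure: "subgroup (rot_closure N) (BijGroup X)"
  unfolding rot_closure_def by (rule subgroup_perm_closure[OF subgroup_rots])

lemma rot_closure_subset_BS_closure: "rot_closure N \<subseteq> BS_closure"
  unfolding rot_closure_def BS_closure_def by (rule perm_closure_mono[OF rots_subset_act])

lemma rot_closure_mult_subset: "rot_closure (N * k) \<subseteq> rot_closure N"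
  unfolding rot_closure_def by (rule perm_closure_mono[OF rots_mult_subset])

lemma rot_closure_1_commute:
  assumes "y \<in> rot_closure 1" "z \<in> rot_closure 1"
  shows "y \<otimes>\<^bsub>BijGroup X\<^esub> z = z \<otimes>\<^bsub>BijGroup X\<^esub> y"
proof (rule perm_closure_commute[OF rots_Bij _ assms[unfolded rot_closure_def]])
  show "g \<otimes>\<^bsub>BijGroup X\<^esub> h = h \<otimes>\<^bsub>BijGroup X\<^esub> g" if "g \<in> rots 1" "h \<in> rots 1" for g h
    using that by (auto simp: rots_def rot_mult add.commute)
qed

text \<open>An element of the Baumslag--Solitar group that approximates \<open>y\<close> at the base coset as well as on
  \<open>F\<close> fixes the base coset, hence is a power of \<open>a\<close>.\<close>

lemma base_stabilizer:
  assumes y: "y \<in> BS_closure" and fixes_base: "y (coset []) = coset []"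
  shows "y \<in> rot_closure 1"
proof -
  have "\<exists>g\<in>rots 1. \<forall>c\<in>F. g c = y c" if F: "finite F" "F \<subseteq> X" for F
  proof -
    have "finite (insert (coset []) F)" "insert (coset []) F \<subseteq> X" using F by simp_all
    then obtain g where g: "g \<in> range act" "\<And>c. c \<in> insert (coset []) F \<Longrightarrow> g c = y c"
      using perm_closureD[OF y[unfolded BS_closure_def]] by metis
    obtain u where u: "g = act u" using g(1) by (elim rangeE)
    have "coset [] = coset u" using g(2)[of "coset []"] fixes_base act_coset[of u "[]"] u by simp
    then obtain k where "bs_class m n u = bs_class m n ([] @ gen_pow Gen_a k)"
      by (rule coset_eqD)
    then have "g = rot (1 * k)" unfolding u rot_def by (intro act_cong) simp
    then have "g \<in> rots 1" unfolding rots_def by (rule range_eqI)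
    then show ?thesis using g(2) by (intro bexI[of _ g]) simp_all
  qed
  then show ?thesis
    using y BS_closure_Bij by (auto simp: rot_closure_def perm_closure_def)
qed

text \<open>The closure of \<open>\<langle>a\<rangle>\<close> is the stabilizer of the base coset, hence open, and the closure of
  \<open>\<langle>a\<^sup>N\<rangle>\<close> has finite index in it.\<close>

lemma compact_open_rot_closure:
  assumes "N \<noteq> 0"
  shows "compact_open_subgroup (BijGroup X\<lparr>carrier := BS_closure\<rparr>) (subtopology (Sym_topology X) BS_closure)
    (rot_closure N)"
  unfolding compact_open_subgroup_def
proof (intro conjI)
  show "subgroup (rot_closure N) (BijGroup X\<lparr>carrier := BS_closure\<rparr>)"
    by (rule Sym.subgroup_incl[OF subgroup_rot_closure subgroup_BS_closure rot_closure_subset_BS_closure])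
  have "compactin (Sym_topology X) (rot_closure N)"
    unfolding rot_closure_def
    by (rule compactin_perm_closure[OF subgroup_rots finite_rots_orbit])
  then show "compactin (subtopology (Sym_topology X) BS_closure) (rot_closure N)"
    using rot_closure_subset_BS_closure by (simp add: compactin_subtopology)
  have "rots 1 \<subseteq> (\<Union>g\<in>(\<lambda>i. rot (1 * i)) ` {0..<\<bar>N\<bar>}. (\<lambda>q. g \<otimes>\<^bsub>BijGroup X\<^esub> q) ` rots (1 * N))"
    by (rule rots_cosets[OF assms])
  moreover have "(\<lambda>i. rot (1 * i)) ` {0..<\<bar>N\<bar>} \<subseteq> Bij X" using rot_Bij by blast
  ultimately obtain F where F: "finite F" "F \<subseteq> X"
    "\<And>y. y \<in> perm_closure X (rots 1) \<Longrightarrow> (\<And>c. c \<in> F \<Longrightarrow> y c = c) \<Longrightarrow>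
      y \<in> perm_closure X (rots (1 * N))"
    using perm_closure_finite_index_open[OF subgroup_rots] by (metis finite_atLeastLessThan_int finite_imageI)
  show "openin (subtopology (Sym_topology X) BS_closure) (rot_closure N)"
  proof (rule openin_subgroup_of_fixator[OF subgroup_BS_closure subgroup_rot_closure rot_closure_subset_BS_closure])
    show "finite (insert (coset []) F)" "insert (coset []) F \<subseteq> X" using F(1,2) by simp_all
    fix y assume y: "y \<in> BS_closure" "\<And>c. c \<in> insert (coset []) F \<Longrightarrow> y c = c"
    then have "y \<in> rot_closure 1" by (intro base_stabilizer) simp_all
    then show "y \<in> rot_closure N" using F(3)[of y] y(2) by (simp add: rot_closure_def)
  qed
qed

text \<open>The exponent sum is constant on each coset of \<open>\<langle>a\<rangle>\<close>, so any word representing any element of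
  the coset may be used.  Consequently the exponent sum of \<open>x\<close> in the closure can be read off from
  the image of the base coset.\<close>

definition coset_expo :: "bs_gen word set set \<Rightarrow> int" where
  "coset_expo C = bs_expo (SOME w. w \<in> \<Union>C)"

lemma coset_expo_coset: "coset_expo (coset u) = bs_expo u"
proof -
  have "u \<in> \<Union>(coset u)"
    by (intro UnionI[OF class_in_coset]) (simp add: in_bs_class_iff pres_eq.refl)
  then have "(SOME w. w \<in> \<Union>(coset u)) \<in> \<Union>(coset u)" by (rule someI)
  then obtain k where "(SOME w. w \<in> \<Union>(coset u)) \<in> bs_class m n (u @ gen_pow Gen_a k)"
    unfolding coset_eq_range by blast
  then have "bs_class m n (u @ gen_pow Gen_a k) = bs_class m n (SOME w. w \<in> \<Union>(coset u))"
    by (simp add: in_bs_class_iff bs_class_eq_iff)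
  then have "bs_expo (u @ gen_pow Gen_a k) = coset_expo (coset u)"
    unfolding coset_expo_def by (rule bs_expo_cong[OF m0 n0])
  then show ?thesis by (simp add: bs_expo_append bs_expo_gen_pow_a)
qed

lemma coset_expo_apply:
  assumes x: "x \<in> BS_closure" and C: "C \<in> X"
  shows "coset_expo (x C) = coset_expo (x (coset [])) + coset_expo C"
proof -
  have "finite {coset [], C}" "{coset [], C} \<subseteq> X" using C by simp_all
  then obtain g where g: "g \<in> range act" "\<And>c. c \<in> {coset [], C} \<Longrightarrow> g c = x c"
    using perm_closureD[OF x[unfolded BS_closure_def]] by metis
  obtain u where u: "g = act u" using g(1) by (elim rangeE)
  obtain v where v: "C = coset v" using C by (rule coset_cases)
  have "x C = coset (u @ v)" "x (coset []) = coset (u @ [])"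
    using g(2)[of C] g(2)[of "coset []"] by (simp_all add: u v act_coset del: append_Nil2)
  then show ?thesis by (simp add: v coset_expo_coset bs_expo_append)
qed

lemma coset_expo_inv_iterate:
  assumes x: "x \<in> BS_closure"
  shows "((inv\<^bsub>BijGroup X\<^esub> x) ^^ k) (coset []) \<in> X \<and>
    coset_expo (((inv\<^bsub>BijGroup X\<^esub> x) ^^ k) (coset [])) = - (int k * coset_expo (x (coset [])))"
proof (induction k)
  case 0
  show ?case by (simp add: coset_expo_coset)
next
  case (Suc k)
  let ?i = "inv\<^bsub>BijGroup X\<^esub> x"
  have xB: "x \<in> Bij X" and iB: "?i \<in> Bij X" using x BS_closure_inv[OF x] BS_closure_Bij by blast+
  have iX: "?i (coset []) \<in> X" by (rule Bij_apply_closed[OF iB coset_closed])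
  have "coset_expo (x (?i (coset []))) = coset_expo (x (coset [])) + coset_expo (?i (coset []))"
    by (rule coset_expo_apply[OF x iX])
  then have "coset_expo (?i (coset [])) = - coset_expo (x (coset []))"
    by (simp add: BijGroup_inv_apply(2)[OF xB coset_closed] coset_expo_coset)
  then show ?case
    using Suc coset_expo_apply[OF BS_closure_inv[OF x], of "(?i ^^ k) (coset [])"]
      Bij_apply_closed[OF iB, of "(?i ^^ k) (coset [])"]
    by (simp add: algebra_simps)
qed

text \<open>If \<open>a\<^sup>i\<close> and \<open>a\<^sup>j\<close> move the coset of \<open>u\<close> to the same place, then \<open>a\<^bsup>j-i\<^esup> u = u a\<^sup>k\<close> for some \<open>k\<close>.  By
  \<open>bs_commutation_ratio\<close> and coprimality, the factor attached to \<open>u\<close> divides \<open>j - i\<close>.\<close>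

lemma orbit_lower_bound:
  assumes C: "C \<in> X"
  shows "nat \<bar>bs_factor m n (- coset_expo C)\<bar> \<le> card ((\<lambda>g. g C) ` rot_closure 1)"
proof -
  obtain u where u: "C = coset u" using C by (rule coset_cases)
  let ?B = "bs_factor m n (- bs_expo u)" and ?f = "\<lambda>i. rot i C"
  have "inj_on ?f {0..<\<bar>?B\<bar>}"
  proof (rule inj_onI)
    fix i j assume ij: "i \<in> {0..<\<bar>?B\<bar>}" "j \<in> {0..<\<bar>?B\<bar>}" and eq: "rot i C = rot j C"
    obtain k where k: "bs_class m n (gen_pow Gen_a j @ u) = bs_class m n ((gen_pow Gen_a i @ u) @ gen_pow Gen_a k)"
      using eq unfolding u rot_coset by (rule coset_eqD)
    have "bs_class m n (gen_pow Gen_a (- i)) \<otimes>\<^bsub>BS m n\<^esub> bs_class m n (gen_pow Gen_a j @ u) =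
        bs_class m n (gen_pow Gen_a (- i)) \<otimes>\<^bsub>BS m n\<^esub> bs_class m n ((gen_pow Gen_a i @ u) @ gen_pow Gen_a k)"
      by (simp only: k)
    then have "bs_class m n (gen_pow Gen_a (- i) @ gen_pow Gen_a j) \<otimes>\<^bsub>BS m n\<^esub> bs_class m n u =
        bs_class m n (gen_pow Gen_a (- i) @ gen_pow Gen_a i) \<otimes>\<^bsub>BS m n\<^esub> bs_class m n (u @ gen_pow Gen_a k)"
      by (simp add: bs_class_mult)
    then have "bs_class m n (gen_pow Gen_a (j - i) @ u) = bs_class m n (gen_pow Gen_a 0 @ u @ gen_pow Gen_a k)"
      unfolding gen_pow_add_class by (simp add: bs_class_mult)
    then have "(j - i) * bs_factor m n (bs_expo u) = k * ?B"
      by (intro bs_commutation_ratio[OF m0 n0]) (simp add: gen_pow_def)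
    then have "?B dvd (j - i) * bs_factor m n (bs_expo u)" by simp
    then have "?B dvd j - i"
      using coprime_bs_factor[OF m0 n0, of "bs_expo u"]
      by (simp add: coprime_dvd_mult_left_iff coprime_commute)
    moreover have "\<bar>j - i\<bar> < \<bar>?B\<bar>" using ij by auto
    ultimately show "i = j" using dvd_imp_le_int[of "j - i" ?B] by fastforce
  qed
  then have "card (?f ` {0..<\<bar>?B\<bar>}) = nat \<bar>?B\<bar>" by (simp add: card_image)
  moreover have "?f ` {0..<\<bar>?B\<bar>} \<subseteq> (\<lambda>g. g C) ` rot_closure 1"
  proof (rule image_subsetI)
    fix i
    have "rot (1 * i) \<in> rots 1" unfolding rots_def by (rule rangeI)
    then have "rot i \<in> rot_closure 1"
      using perm_closure_superset[OF rots_Bij] by (auto simp: rot_closure_def)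
    then show "rot i C \<in> (\<lambda>g. g C) ` rot_closure 1" by (rule imageI)
  qed
  moreover have "finite ((\<lambda>g. g C) ` rot_closure 1)"
    using compact_open_rot_closure[of 1] compactin_finite_orbit[OF BS_closure_Bij _ C]
    by (simp add: compact_open_subgroup_def)
  ultimately show ?thesis using card_mono by (metis u coset_expo_coset)
qed

text \<open>The index is bounded by choosing \<open>N\<close> such that conjugation by \<open>x\<close> carries the closure of a
  subgroup \<open>\<langle>a\<^bsup>NB\<^esup>\<rangle>\<close>, with \<open>\<bar>B\<bar>\<close> the bound, into the closure of \<open>\<langle>a\<^sup>N\<rangle>\<close>.\<close>

lemma index_upper_bound:
  assumes x: "x \<in> BS_closure"
  obtains N where "N \<noteq> 0"
    "card ((\<lambda>v. v <#\<^bsub>BijGroup X\<^esub> {v \<in> rot_closure N.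
        x \<otimes>\<^bsub>BijGroup X\<^esub> v \<otimes>\<^bsub>BijGroup X\<^esub> inv\<^bsub>BijGroup X\<^esub> x \<in> rot_closure N}) ` rot_closure N)
      \<le> nat \<bar>bs_factor m n (coset_expo (x (coset [])))\<bar>"
proof -
  let ?inv = "\<lambda>y. inv\<^bsub>BijGroup X\<^esub> y"
  have xB: "x \<in> Bij X" using x BS_closure_Bij by blast
  obtain g where g: "g \<in> range act" "\<And>c. c \<in> {coset []} \<Longrightarrow> g c = x c"
    using perm_closureD[OF x[unfolded BS_closure_def], of "{coset []}"] by auto
  obtain u where u: "g = act u" using g(1) by (elim rangeE)
  have xo: "x (coset []) = act u (coset [])" using g(2) u by simp
  then have expo: "coset_expo (x (coset [])) = bs_expo u" by (simp add: act_coset coset_expo_coset)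
  (* The part of x in the stabilizer of the base coset; being in an abelian group that contains
     all powers of a, it has no effect on their conjugates. *)
  define v0 where "v0 = ?inv (act u) \<otimes>\<^bsub>BijGroup X\<^esub> x"
  have v0_closure: "v0 \<in> BS_closure"
    unfolding v0_def by (intro subgroup.m_closed[OF subgroup_BS_closure] BS_closure_inv act_BS_closure x)
  have "v0 (coset []) = coset []"
    unfolding v0_def
    by (simp add: BijGroup_mult_apply Bij_inv_closed act_Bij xB xo BijGroup_inv_apply(1))
  then have v0: "v0 \<in> rot_closure 1" by (rule base_stabilizer[OF v0_closure])
  have v0B: "v0 \<in> Bij X" using v0_closure BS_closure_Bij by blast
  have x_eq: "x = act u \<otimes>\<^bsub>BijGroup X\<^esub> v0"
    unfolding v0_def using xB act_Bij[of u] by (simp add: Sym.inv_cancel_left)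
  obtain N N' where N: "N \<noteq> 0"
    "\<And>k. bs_class m n (gen_pow Gen_a (N * k) @ u) = bs_class m n (u @ gen_pow Gen_a (N' * k))"
    using commensurated_words[of u] by metis
  let ?B = "bs_factor m n (bs_expo u)" and ?A = "bs_factor m n (- bs_expo u)"
  (* The common multiple of N and N' for which the index of the closures is |?B|. *)
  have L: "N * ?B = N' * ?A"
    using bs_commutation_ratio[OF m0 n0 N(2)[of 1]] by simp
  define W where "W = {v \<in> rot_closure N.
    x \<otimes>\<^bsub>BijGroup X\<^esub> v \<otimes>\<^bsub>BijGroup X\<^esub> ?inv x \<in> rot_closure N}"
  have sW: "subgroup W (BijGroup X)"
    unfolding W_def by (rule Sym.subgroup_Int_conj[OF subgroup_rot_closure]) (use xB in simp)
  have sub: "rot_closure (N * ?B) \<subseteq> W"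
  proof
    fix y assume y: "y \<in> rot_closure (N * ?B)"
    have yB: "y \<in> Bij X" using y rot_closure_subset_BS_closure BS_closure_Bij by blast
    have "y \<in> rot_closure 1" using y rot_closure_mult_subset[of 1 "N * ?B"] by auto
    then have comm: "v0 \<otimes>\<^bsub>BijGroup X\<^esub> y = y \<otimes>\<^bsub>BijGroup X\<^esub> v0" by (rule rot_closure_1_commute[OF v0])
    have "x \<otimes>\<^bsub>BijGroup X\<^esub> y \<otimes>\<^bsub>BijGroup X\<^esub> ?inv x =
        act u \<otimes>\<^bsub>BijGroup X\<^esub> (v0 \<otimes>\<^bsub>BijGroup X\<^esub> y) \<otimes>\<^bsub>BijGroup X\<^esub> (?inv v0 \<otimes>\<^bsub>BijGroup X\<^esub> ?inv (act u))"
      unfolding x_eq using v0B yB act_Bij[of u] by (simp add: Sym.inv_mult_group Sym.m_assoc Bij_inv_closed Bij_mult_closed)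
    also have "\<dots> = act u \<otimes>\<^bsub>BijGroup X\<^esub> y \<otimes>\<^bsub>BijGroup X\<^esub> ?inv (act u)"
      unfolding comm using v0B yB act_Bij[of u] by (simp add: Sym.m_assoc Sym.inv_cancel_left Bij_inv_closed Bij_mult_closed)
    also have "\<dots> \<in> rot_closure N"
      unfolding rot_closure_def
    proof (rule perm_closure_conj[OF _ rots_Bij act_Bij y[unfolded rot_closure_def]])
      fix p assume "p \<in> rots (N * ?B)"
      then obtain k where k: "p = rot (N * ?B * k)" unfolding rots_def by (elim rangeE)
      have "act u \<otimes>\<^bsub>BijGroup X\<^esub> p = act (u @ gen_pow Gen_a (N' * (?A * k)))"
        unfolding k L rot_def act_mult by (simp only: mult.assoc)
      also have "\<dots> = act (gen_pow Gen_a (N * (?A * k)) @ u)" by (rule act_cong[OF N(2)[symmetric]])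
      also have "\<dots> = rot (N * (?A * k)) \<otimes>\<^bsub>BijGroup X\<^esub> act u" by (simp only: rot_def act_mult)
      finally have "act u \<otimes>\<^bsub>BijGroup X\<^esub> p \<otimes>\<^bsub>BijGroup X\<^esub> ?inv (act u) = rot (N * (?A * k))"
        using act_Bij[of u] rot_Bij by (simp add: Sym.m_assoc Bij_inv_closed Bij_mult_closed)
      then show "act u \<otimes>\<^bsub>BijGroup X\<^esub> p \<otimes>\<^bsub>BijGroup X\<^esub> ?inv (act u) \<in> rots N"
        unfolding rots_def by (rule range_eqI)
    qed
    finally show "y \<in> W"
      using y rot_closure_mult_subset[of N ?B] by (auto simp: W_def)
  qed
  have B0: "?B \<noteq> 0" by (rule bs_factor_nonzero[OF m0 n0])
  let ?I = "(\<lambda>i. rot (N * i)) ` {0..<\<bar>?B\<bar>}"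
  have "(\<lambda>v. v <#\<^bsub>BijGroup X\<^esub> W) ` rot_closure N \<subseteq> (\<lambda>v. v <#\<^bsub>BijGroup X\<^esub> W) ` ?I"
  proof (rule image_subsetI)
    fix v assume v: "v \<in> rot_closure N"
    have "finite ?I" "?I \<subseteq> Bij X" using rot_Bij by auto
    then obtain g where g: "g \<in> ?I" "?inv g \<otimes>\<^bsub>BijGroup X\<^esub> v \<in> rot_closure (N * ?B)"
      using perm_closure_cosets[OF rots_Bij _ _ rots_cosets[OF B0] v[unfolded rot_closure_def]]
      unfolding rot_closure_def by metis
    have "g \<in> Bij X" "v \<in> Bij X"
      using g(1) rot_Bij v rot_closure_subset_BS_closure BS_closure_Bij by blast+
    then have "g <#\<^bsub>BijGroup X\<^esub> W = v <#\<^bsub>BijGroup X\<^esub> W"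
      using g(2) sub by (intro Sym.lcoset_eqI[OF sW]) auto
    then show "v <#\<^bsub>BijGroup X\<^esub> W \<in> (\<lambda>v. v <#\<^bsub>BijGroup X\<^esub> W) ` ?I"
      using g(1) by (metis imageI)
  qed
  then have "card ((\<lambda>v. v <#\<^bsub>BijGroup X\<^esub> W) ` rot_closure N) \<le> card ((\<lambda>v. v <#\<^bsub>BijGroup X\<^esub> W) ` ?I)"
    by (intro card_mono) simp_all
  also have "\<dots> \<le> card {0..<\<bar>?B\<bar>}"
    unfolding image_image by (rule card_image_le) simp
  also have "\<dots> = nat \<bar>?B\<bar>" by simp
  finally show thesis using that[OF N(1)] expo by (simp add: W_def)
qed

text \<open>By \<open>coset_expo_inv_iterate\<close>, the points \<open>x\<^sup>-\<^sup>k o\<close> have exponent sum \<open>- k \<rho>\<close>, so the orbit bound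
  at these points is the \<open>k\<close>-th power of the bound for \<open>k = 1\<close>, as the growth argument requires.\<close>

lemma scale_eq:
  assumes x: "x \<in> BS_closure"
  shows "tdlc_scale (GBS m n) (GBS_topology m n) x = nat \<bar>bs_factor m n (coset_expo (x (coset [])))\<bar>"
proof -
  let ?\<rho> = "coset_expo (x (coset []))"
  obtain N where N: "N \<noteq> 0"
    "card ((\<lambda>v. v <#\<^bsub>BijGroup X\<^esub> {v \<in> rot_closure N.
        x \<otimes>\<^bsub>BijGroup X\<^esub> v \<otimes>\<^bsub>BijGroup X\<^esub> inv\<^bsub>BijGroup X\<^esub> x \<in> rot_closure N}) ` rot_closure N)
      \<le> nat \<bar>bs_factor m n ?\<rho>\<bar>"
    by (rule index_upper_bound[OF x])
  show ?thesis
    unfolding GBS_eq GBS_topology_eq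
  proof (rule tdlc_scale_eqI[OF subgroup_BS_closure x coset_closed[of "[]"] compact_open_rot_closure[of 1]
        compact_open_rot_closure[OF N(1)] _ N(2)])
    fix k
    let ?p = "((inv\<^bsub>BijGroup X\<^esub> x) ^^ k) (coset [])"
    have p: "?p \<in> X" "coset_expo ?p = - (int k * ?\<rho>)"
      using coset_expo_inv_iterate[OF x, of k] by (rule conjunct1, rule conjunct2)
    have "nat \<bar>bs_factor m n ?\<rho>\<bar> ^ k = nat \<bar>bs_factor m n (- coset_expo ?p)\<bar>"
      unfolding p(2) minus_minus bs_factor_mult_nat power_abs by (rule nat_power_eq[symmetric]) simp
    also have "\<dots> \<le> card ((\<lambda>g. g ?p) ` rot_closure 1)" by (rule orbit_lower_bound[OF p(1)])
    finally show "nat \<bar>bs_factor m n ?\<rho>\<bar> ^ k \<le> card ((\<lambda>u. u ?p) ` rot_closure 1)" .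
  qed simp
qed

lemma scales_eq_range:
  "{tdlc_scale (GBS m n) (GBS_topology m n) x |x. x \<in> carrier (GBS m n)} =
    range (\<lambda>\<rho>. nat \<bar>bs_factor m n \<rho>\<bar>)"
proof (intro equalityI subsetI)
  fix s assume "s \<in> {tdlc_scale (GBS m n) (GBS_topology m n) x |x. x \<in> carrier (GBS m n)}"
  then obtain x where "s = tdlc_scale (GBS m n) (GBS_topology m n) x" "x \<in> carrier (GBS m n)"
    by blast
  moreover from this have "x \<in> BS_closure" by (simp add: GBS_eq)
  ultimately show "s \<in> range (\<lambda>\<rho>. nat \<bar>bs_factor m n \<rho>\<bar>)" using scale_eq by blast
next
  fix s assume "s \<in> range (\<lambda>\<rho>. nat \<bar>bs_factor m n \<rho>\<bar>)"
  then obtain \<rho> where \<rho>: "s = nat \<bar>bs_factor m n \<rho>\<bar>" by (elim rangeE)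
  have rep: "bs_expo (replicate j (Gen_t, b)) = (if b then int j else - int j)" for j b
    by (induction j) auto
  have "bs_expo (replicate (nat \<bar>\<rho>\<bar>) (Gen_t, \<rho> \<ge> 0)) = \<rho>" by (simp add: rep)
  then have "tdlc_scale (GBS m n) (GBS_topology m n) (act (replicate (nat \<bar>\<rho>\<bar>) (Gen_t, \<rho> \<ge> 0))) = s"
    using scale_eq[OF act_BS_closure] by (simp add: \<rho> act_coset coset_expo_coset)
  then show "s \<in> {tdlc_scale (GBS m n) (GBS_topology m n) x |x. x \<in> carrier (GBS m n)}"
    using act_BS_closure by (auto simp: GBS_eq)
qed

end

lemma abs_div_gcd_eq_lcm_div:
  fixes m n :: int
  assumes "m \<noteq> 0" "n \<noteq> 0"
  shows "real_of_int \<bar>m div gcd m n\<bar> = real_of_int (lcm m n) / real_of_int \<bar>n\<bar>"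
proof -
  have "m div gcd m n * gcd m n = m" by simp
  then have "\<bar>m\<bar> = \<bar>m div gcd m n\<bar> * gcd m n" by (metis abs_gcd_int abs_mult)
  then have "\<bar>m div gcd m n\<bar> * \<bar>n\<bar> * gcd m n = lcm m n * gcd m n"
    using prod_gcd_lcm_int[of m n] by (simp add: mult_ac)
  moreover have "gcd m n \<noteq> 0" using assms by simp
  ultimately have "\<bar>m div gcd m n\<bar> * \<bar>n\<bar> = lcm m n" using mult_right_cancel by blast
  then have "real_of_int \<bar>m div gcd m n\<bar> * real_of_int \<bar>n\<bar> = real_of_int (lcm m n)"
    by (metis of_int_mult)
  then show ?thesis using assms(2) by (simp add: eq_divide_eq)
qed

theorem theorem6p12:
  fixes m n :: int
  assumes "m \<noteq> 0" and "n \<noteq> 0"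
  shows "{real (tdlc_scale (GBS m n) (GBS_topology m n) x) |x. x \<in> carrier (GBS m n)} =
    {(real_of_int (lcm m n) / real_of_int \<bar>n\<bar>) ^ \<rho> |\<rho> :: nat. True} \<union>
    {(real_of_int (lcm m n) / real_of_int \<bar>m\<bar>) ^ \<rho> |\<rho> :: nat. True}"
proof -
  interpret BS_nonzero m n using assms by unfold_locales
  let ?q = "real_of_int (lcm m n) / real_of_int \<bar>n\<bar>" and ?r = "real_of_int (lcm m n) / real_of_int \<bar>m\<bar>"
  have q: "real_of_int \<bar>m div gcd m n\<bar> = ?q"
    by (rule abs_div_gcd_eq_lcm_div[OF assms])
  have r: "real_of_int \<bar>n div gcd m n\<bar> = ?r"
    using abs_div_gcd_eq_lcm_div[OF assms(2,1)] by (simp add: gcd.commute lcm.commute)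
  have val: "real (nat \<bar>bs_factor m n \<rho>\<bar>) = (if \<rho> \<ge> 0 then ?q ^ nat \<rho> else ?r ^ nat (- \<rho>))" for \<rho>
    by (simp only: bs_factor_def q[symmetric] r[symmetric]) (simp add: power_abs)
  have "{real (tdlc_scale (GBS m n) (GBS_topology m n) x) |x. x \<in> carrier (GBS m n)} =
      real ` {tdlc_scale (GBS m n) (GBS_topology m n) x |x. x \<in> carrier (GBS m n)}"
    by blast
  also have "\<dots> = range (\<lambda>\<rho>. if \<rho> \<ge> 0 then ?q ^ nat \<rho> else ?r ^ nat (- \<rho>))"
    unfolding scales_eq_range image_image val ..
  also have "\<dots> = range (\<lambda>k. ?q ^ k) \<union> range (\<lambda>k. ?r ^ k)" (is "range ?f = _")
  proof (intro equalityI subsetI)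
    fix s assume "s \<in> range (\<lambda>k. ?q ^ k) \<union> range (\<lambda>k. ?r ^ k)"
    then consider k where "s = ?q ^ k" | k where "s = ?r ^ k" by blast
    then show "s \<in> range ?f"
    proof cases
      case (1 k)
      then have "s = ?f (int k)" by simp
      then show ?thesis by (rule range_eqI)
    next
      case (2 k)
      then have "s = ?f (- int k)" by (cases "k = 0") simp_all
      then show ?thesis by (rule range_eqI)
    qed
  qed auto
  finally show ?thesis by (simp add: full_SetCompr_eq)
qed

end
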